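(* Let $\theta\in(0,1)$ and let $(\Sigma,\sigma)$ be the one-sided countable full shift equipped with the metric $$d_1(\underline{x},\underline{y})=\sum_{n\ge 0}\theta^n\left|\frac1{x_n}-\frac1{y_n}\right|.$$ Let $\phi:\Sigma\to\mathbb{R}$ be a potential such that $\phi|_{[n]}\le-\kappa\log(n+1)$ (for $n\in\mathbb{N}$) for some $\kappa>1$, which admits the Gibbs measure $\mu$. Then there exist $0<c<C<\infty$ and $\varepsilon>0$ such that for all $\delta>0$, $$\frac{c}{M_\mu(\delta/\varepsilon)}\le\mathbb{E}(\tau_\delta)\le\frac{C}{M_\mu(\varepsilon\delta)}\left(\log\frac1\delta\right)^2.$$
   Context: Here $\mathbb{N}=\{1,2,\dots\}$, $\mathbb{N}_0=\mathbb{N}\cup\{0\}$. The one-sided countable full shift is $\Sigma=\mathbb{N}^{\mathbb{N}_0}$, with elements $\underline{x}=(x_0,x_1,\dots)$, and shift map $\sigma(x_0,x_1,x_2,\dots)=(x_1,x_2,\dots)$. For $y_0,\dots,y_{n-1}\in\mathbb{N}$ the $n$-cylinder is $[y_0,\dots,y_{n-1}]=\{\underline{x}\in\Sigma:x_0=y_0,\dots,x_{n-1}=y_{n-1}\}$; in particular $[n]=\{\underline{x}\in\Sigma:x_0=n\}$. Gibbs measure: a $\sigma$-invariant probability measure $\mu$ on $\Sigma$ is a Gibbs measure for $\phi$ if there are constants $K>1$ and $P$ such that for every $n$, every $n$-cylinder $Z_n$ and every $\underline{x}\in Z_n$, $$K^{-1}\le\frac{\mu(Z_n)}{e^{S_n\phi(\underline{x})-nP}}\le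 K,\qquad S_n\phi(\underline{x})=\sum_{i=0}^{n-1}\phi(\sigma^i(\underline{x})).$$ A set $A$ is $\delta$-dense in $\Sigma$ if for every $b\in\Sigma$ there is $a\in A$ with $d_1(a,b)\le\delta$. The $\delta$-covering time is $\tau_\delta:\Sigma\to\mathbb{N}\cup\{\infty\}$, $$\tau_\delta(\underline{x})=\inf\{n\ge1:\{\underline{x},\sigma(\underline{x}),\dots,\sigma^n(\underline{x})\}\text{ is }\delta\text{-dense in }\Sigma\},$$ and $\mathbb{E}(\tau_\delta)=\int\tau_\delta\,d\mu$ is its expectation with respect to $\mu$. $M_\mu(r)=\min_{\underline{x}\in\operatorname{supp}(\mu)}\mu(B(\underline{x},r))$, where $B(\underline{x},r)$ is the ball of radius $r$ about $\underline{x}$ in the metric $d_1$.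
   Formalization: The upper bound fails at and near δ = 1, where log(1/δ) vanishes but E(τ_δ) ≥ 1; it is proved for all δ > 0 with |δ − 1| ≥ η, for any fixed η > 0, with c, C, ε allowed to depend on η; the minimum in M_μ is read as an infimum. *)

theory Defs
  imports "HOL-Probability.Probability"
begin

text \<open>Points of the full shift are sequences of \<^emph>\<open>positive\<close> naturals. Functions such as the potential
  live on the whole type \<^typ>\<open>nat \<Rightarrow> nat\<close>; only their values on \<open>full_shift\<close> matter.\<close>

definition full_shift :: "(nat \<Rightarrow> nat) set" where
  "full_shift = {x. \<forall>n. 1 \<le> x n}"

definition shift :: "(nat \<Rightarrow> nat) \<Rightarrow> (nat \<Rightarrow> nat)" where
  "shift x = (\<lambda>n. x (Suc n))"

definition cylinder :: "nat list \<Rightarrow> (nat \<Rightarrow> nat) set" where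
  "cylinder w = {x \<in> full_shift. \<forall>i<length w. x i = w ! i}"

definition d1 :: "real \<Rightarrow> (nat \<Rightarrow> nat) \<Rightarrow> (nat \<Rightarrow> nat) \<Rightarrow> real" where
  "d1 \<theta> x y = (\<Sum>n. \<theta> ^ n * \<bar>1 / real (x n) - 1 / real (y n)\<bar>)"

lemma summable_d1:
  assumes "0 < \<theta>" "\<theta> < 1"
  shows "summable (\<lambda>n. \<theta> ^ n * \<bar>1 / real (x n) - 1 / real (y n)\<bar>)"
proof (rule summable_comparison_test')
  show "summable (\<lambda>n. \<theta> ^ n)"
    using assms by (intro summable_geometric) auto
  fix n :: nat
  have "0 \<le> 1 / real k \<and> 1 / real k \<le> 1" for k :: nat
    by (cases k) auto
  from this[of "x n"] this[of "y n"] have "\<bar>1 / real (x n) - 1 / real (y n)\<bar> \<le> 1"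
    by linarith
  then show "norm (\<theta> ^ n * \<bar>1 / real (x n) - 1 / real (y n)\<bar>) \<le> \<theta> ^ n"
    using assms by (simp add: abs_mult mult_left_le)
qed

lemma Metric_space_d1:
  assumes "0 < \<theta>" "\<theta> < 1"
  shows "Metric_space full_shift (d1 \<theta>)"
proof
  note sm = summable_d1[OF assms]
  fix x y z
  show "0 \<le> d1 \<theta> x y"
    unfolding d1_def using assms by (intro suminf_nonneg sm) auto
  show "d1 \<theta> x y = d1 \<theta> y x"
    by (simp add: d1_def abs_minus_commute)
  show "d1 \<theta> x y = 0 \<longleftrightarrow> x = y" if "x \<in> full_shift" "y \<in> full_shift"
  proof -
    have pos: "x n \<noteq> 0" "y n \<noteq> 0" for n
      using that by (auto simp: full_shift_def dest!: spec[of _ n])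
    have "d1 \<theta> x y = 0 \<longleftrightarrow> (\<forall>n. \<theta> ^ n * \<bar>1 / real (x n) - 1 / real (y n)\<bar> = 0)"
      unfolding d1_def using assms by (intro suminf_eq_zero_iff sm) auto
    also have "\<dots> \<longleftrightarrow> (\<forall>n. x n = y n)"
      using assms by (auto simp: field_simps pos)
    finally show ?thesis by auto
  qed
  show "d1 \<theta> x z \<le> d1 \<theta> x y + d1 \<theta> y z"
  proof -
    have "d1 \<theta> x z \<le> (\<Sum>n. \<theta> ^ n * \<bar>1 / real (x n) - 1 / real (y n)\<bar>
        + \<theta> ^ n * \<bar>1 / real (y n) - 1 / real (z n)\<bar>)"
      unfolding d1_def
    proof (intro suminf_le sm summable_add)
      fix n
      have "\<bar>1 / real (x n) - 1 / real (z n)\<bar>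
          \<le> \<bar>1 / real (x n) - 1 / real (y n)\<bar> + \<bar>1 / real (y n) - 1 / real (z n)\<bar>"
        by linarith
      then have "\<theta> ^ n * \<bar>1 / real (x n) - 1 / real (z n)\<bar>
          \<le> \<theta> ^ n * (\<bar>1 / real (x n) - 1 / real (y n)\<bar> + \<bar>1 / real (y n) - 1 / real (z n)\<bar>)"
        using assms by (intro mult_left_mono) auto
      then show "\<theta> ^ n * \<bar>1 / real (x n) - 1 / real (z n)\<bar>
          \<le> \<theta> ^ n * \<bar>1 / real (x n) - 1 / real (y n)\<bar> + \<theta> ^ n * \<bar>1 / real (y n) - 1 / real (z n)\<bar>"
        by (simp only: distrib_left)
    qed
    also have "\<dots> = d1 \<theta> x y + d1 \<theta> y z"
      unfolding d1_def by (intro suminf_add[symmetric] sm)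
    finally show ?thesis .
  qed
qed

text \<open>The \<open>\<sigma>\<close>-algebra generated by the cylinders. It is also the Borel \<open>\<sigma>\<close>-algebra of \<^term>\<open>d1 \<theta>\<close>
  for \<open>0 < \<theta> < 1\<close>: the metric induces the product topology, in which the countably many
  cylinders form a base.\<close>

definition shift_space :: "(nat \<Rightarrow> nat) measure" where
  "shift_space = (\<Pi>\<^sub>M i\<in>UNIV. count_space {1::nat..})"

lemma space_shift_space: "space shift_space = full_shift"
  by (auto simp: shift_space_def full_shift_def space_PiM PiE_def Pi_def extensional_def)

definition birkhoff_sum :: "((nat \<Rightarrow> nat) \<Rightarrow> real) \<Rightarrow> nat \<Rightarrow> (nat \<Rightarrow> nat) \<Rightarrow> real" where
  "birkhoff_sum \<phi> n x = (\<Sum>i<n. \<phi> ((shift ^^ i) x))"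

definition invariant_prob :: "(nat \<Rightarrow> nat) measure \<Rightarrow> bool" where
  "invariant_prob \<mu> \<longleftrightarrow> prob_space \<mu> \<and> sets \<mu> = sets shift_space \<and>
     (\<forall>A\<in>sets \<mu>. emeasure \<mu> (shift -` A \<inter> space \<mu>) = emeasure \<mu> A)"

definition gibbs_measure :: "((nat \<Rightarrow> nat) \<Rightarrow> real) \<Rightarrow> (nat \<Rightarrow> nat) measure \<Rightarrow> bool" where
  "gibbs_measure \<phi> \<mu> \<longleftrightarrow> invariant_prob \<mu> \<and>
     (\<exists>K>1. \<exists>P. \<forall>w. w \<noteq> [] \<and> set w \<subseteq> {1..} \<longrightarrow>
        (\<forall>x\<in>cylinder w.
           1 / K \<le> measure \<mu> (cylinder w) / exp (birkhoff_sum \<phi> (length w) x - real (length w) * P) \<and>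
           measure \<mu> (cylinder w) / exp (birkhoff_sum \<phi> (length w) x - real (length w) * P) \<le> K))"

definition delta_dense :: "real \<Rightarrow> real \<Rightarrow> (nat \<Rightarrow> nat) set \<Rightarrow> bool" where
  "delta_dense \<theta> \<delta> A \<longleftrightarrow> (\<forall>b\<in>full_shift. \<exists>a\<in>A. d1 \<theta> a b \<le> \<delta>)"

text \<open>The infimum is taken in \<^typ>\<open>enat\<close>, so it is \<open>\<infinity>\<close> if the orbit never becomes \<open>\<delta>\<close>-dense.\<close>

definition covering_time :: "real \<Rightarrow> real \<Rightarrow> (nat \<Rightarrow> nat) \<Rightarrow> enat" where
  "covering_time \<theta> \<delta> x =
     (INF n\<in>{n. 1 \<le> n \<and> delta_dense \<theta> \<delta> {(shift ^^ i) x |i. i \<le> n}}. enat n)"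

definition expected_covering_time :: "real \<Rightarrow> (nat \<Rightarrow> nat) measure \<Rightarrow> real \<Rightarrow> ennreal" where
  "expected_covering_time \<theta> \<mu> \<delta> = (\<integral>\<^sup>+x. ennreal_of_enat (covering_time \<theta> \<delta> x) \<partial>\<mu>)"

definition supp :: "real \<Rightarrow> (nat \<Rightarrow> nat) measure \<Rightarrow> (nat \<Rightarrow> nat) set" where
  "supp \<theta> \<mu> = {x \<in> full_shift.
     \<forall>U. openin (Metric_space.mtopology full_shift (d1 \<theta>)) U \<and> x \<in> U \<longrightarrow> 0 < emeasure \<mu> U}"

text \<open>The minimal measure of a ball of radius \<open>r\<close> centred in the support. The space is not compact,
  so the minimum need not be attained and is read as an infimum. It is \<^typ>\<open>ennreal\<close>-valued, so
  that \<open>c / 0 = \<infinity>\<close> for \<open>c > 0\<close>.\<close>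

definition min_ball_measure :: "real \<Rightarrow> (nat \<Rightarrow> nat) measure \<Rightarrow> real \<Rightarrow> ennreal" where
  "min_ball_measure \<theta> \<mu> r =
     (INF x\<in>supp \<theta> \<mu>. emeasure \<mu> (Metric_space.mball full_shift (d1 \<theta>) x r))"

end

theory Submission
  imports Defs
begin

text \<open>
  The Gibbs property makes the measure quasi-Bernoulli: with a constant \<open>D\<close>,
  \<open>\<mu>[u] \<mu>[v] / D \<le> \<mu>[uv] \<le> D \<mu>[u] \<mu>[v]\<close> for all words \<open>u\<close>, \<open>v\<close>. The dependence between past and
  future is thus bounded by a factor, and this replaces independence throughout.

  The lower bound holds because a \<open>\<delta>\<close>-dense orbit has entered the ball of radius \<open>\<delta>/\<epsilon> > \<delta>\<close> about
  every point. By invariance it does so within \<open>n\<close> steps with probability at most \<open>n\<close> times the measure \<open>g\<close> of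
  the ball, so the covering time exceeds a multiple of \<open>1/g\<close> with probability at least \<open>1/2\<close>. Taking
  the best centre gives \<open>1/M\<^sub>\<mu>(\<delta>/\<epsilon>)\<close> (\<open>expected_covering_time_ge\<close>).

  For the upper bound, observe that up to an error of order \<open>\<delta>\<close> a point is described by its
  first \<open>k \<approx> log (1/\<delta>)\<close> symbols,
  each symbol above \<open>N \<approx> 1/\<delta>\<close> being replaced by \<open>N\<close>. So the orbit is \<open>\<delta>\<close>-dense once it has visited a
  neighbourhood \<open>B\<close> of each of at most \<open>N\<^sup>k\<close> centres, where \<open>B\<close> depends on \<open>k\<close> coordinates and has measure at
  least \<open>M\<^sub>\<mu>(\<epsilon>\<delta>)\<close>. In a time window of length \<open>L \<approx> 1/\<mu>(B)\<close> the orbit visits \<open>B\<close> with probability bounded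
  below (\<open>prob_hit_ge\<close>), and up to the factor \<open>D\<close> this remains true conditionally on what happened
  before the window (\<open>prob_Int_preimage_compl_le\<close>). Consequently the probability to miss \<open>B\<close> in \<open>n\<close>
  successive windows decays exponentially in \<open>n\<close>, and a union bound over the centres gives
  an expected covering time of order \<open>(1/M\<^sub>\<mu>(\<epsilon>\<delta>)) log (N\<^sup>k)\<close>
  (\<open>nn_integral_collection_time_le\<close>), where \<open>log (N\<^sup>k) = k log N\<close> is of order \<open>(log (1/\<delta>))\<^sup>2\<close>.

  The delicate point is that a window of length \<open>1/\<mu>(B)\<close>, not \<open>k/\<mu>(B)\<close>, suffices; the latter would cost a
  third logarithm. It rests on a second moment estimate. The number of visits in the window
  has mean about 1, and its second moment is bounded if immediate returns to \<open>B\<close> are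
  unlikely. They are, since the radius of \<open>B\<close> is so small that each of the \<open>k\<close> prescribed coordinates
  excludes the symbol 1 or the symbol 2, so that the first \<open>j\<close> conditions alone have probability at
  most \<open>\<rho>\<^sup>j\<close> for some \<open>\<rho> < 1\<close> (\<open>prob_return_le\<close>).

  The factor \<open>(log (1/\<delta>))\<^sup>2\<close> vanishes at \<open>\<delta> = 1\<close>, and additive constants can be absorbed into it
  only at a distance \<open>\<eta>\<close> from there. For \<open>\<delta> > 1\<close> the upper bound reduces to the finiteness of the
  expectation at \<open>\<delta> = 1/2\<close>.
\<close>

section \<open>Events that depend on finitely many coordinates\<close>

lemma funpow_shift: "(shift ^^ n) x = (\<lambda>i. x (i + n))"
  by (induction n) (simp_all add: shift_def)

lemma funpow_shift_in_full_shift: "x \<in> full_shift \<Longrightarrow> (shift ^^ n) x \<in> full_shift"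
  by (simp add: funpow_shift full_shift_def)

text \<open>The preimage under \<open>\<sigma>\<^sup>n\<close>, cut down to the full shift so that complements are taken there.\<close>

definition preimage_shift :: "nat \<Rightarrow> (nat \<Rightarrow> nat) set \<Rightarrow> (nat \<Rightarrow> nat) set" where
  "preimage_shift n A = {x \<in> full_shift. (shift ^^ n) x \<in> A}"

definition determined_by :: "nat \<Rightarrow> (nat \<Rightarrow> nat) set \<Rightarrow> bool" where
  "determined_by n A \<longleftrightarrow>
     A \<subseteq> full_shift \<and> (\<forall>x\<in>A. \<forall>y\<in>full_shift. (\<forall>i<n. x i = y i) \<longrightarrow> y \<in> A)"

lemma determined_by_subset: "determined_by n A \<Longrightarrow> A \<subseteq> full_shift"
  by (simp add: determined_by_def)

lemma determined_by_mono: "determined_by n A \<Longrightarrow> n \<le> m \<Longrightarrow> determined_by m A"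
  unfolding determined_by_def by (meson order_less_le_trans)

lemma determined_by_Int: "determined_by n A \<Longrightarrow> determined_by n B \<Longrightarrow> determined_by n (A \<inter> B)"
  unfolding determined_by_def by blast

lemma determined_by_UN: "(\<And>i. i \<in> I \<Longrightarrow> determined_by n (A i)) \<Longrightarrow> determined_by n (\<Union>i\<in>I. A i)"
  unfolding determined_by_def by (intro conjI; blast)

lemma determined_by_compl: "determined_by n A \<Longrightarrow> determined_by n (full_shift - A)"
  unfolding determined_by_def by (metis DiffE DiffI Diff_subset)

lemma determined_by_full_shift: "determined_by n full_shift"
  by (simp add: determined_by_def)

lemma determined_by_preimage_shift:
  assumes "determined_by n A"
  shows "determined_by (m + n) (preimage_shift m A)"
  unfolding determined_by_def
proof (intro conjI ballI impI)
  show "preimage_shift m A \<subseteq> full_shift" by (auto simp: preimage_shift_def)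
  fix x y assume x: "x \<in> preimage_shift m A" and y: "y \<in> full_shift"
    and eq: "\<forall>i<m + n. x i = y i"
  have "\<forall>i<n. (shift ^^ m) x i = (shift ^^ m) y i"
    using eq by (simp add: funpow_shift)
  then have "(shift ^^ m) y \<in> A"
    using assms x funpow_shift_in_full_shift[OF y] unfolding determined_by_def preimage_shift_def
    by blast
  then show "y \<in> preimage_shift m A" using y by (simp add: preimage_shift_def)
qed

lemma preimage_shift_compl: "preimage_shift n (full_shift - A) = full_shift - preimage_shift n A"
  by (auto simp: preimage_shift_def funpow_shift_in_full_shift)

lemma preimage_shift_Int: "preimage_shift n (A \<inter> B) = preimage_shift n A \<inter> preimage_shift n B"
  by (auto simp: preimage_shift_def)

lemma preimage_shift_preimage_shift:
  "preimage_shift m (preimage_shift n A) = preimage_shift (m + n) A"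
  by (auto simp: preimage_shift_def funpow_shift funpow_shift_in_full_shift full_shift_def add_ac)

lemma preimage_shift_0: "A \<subseteq> full_shift \<Longrightarrow> preimage_shift 0 A = A"
  by (auto simp: preimage_shift_def)

definition box :: "nat \<Rightarrow> (nat \<Rightarrow> nat set) \<Rightarrow> (nat \<Rightarrow> nat) set" where
  "box n S = {x \<in> full_shift. \<forall>i<n. x i \<in> S i}"

lemma determined_by_box: "determined_by n (box n S)"
  by (auto simp: determined_by_def box_def)

definition words_inside :: "nat \<Rightarrow> (nat \<Rightarrow> nat) set \<Rightarrow> nat list set" where
  "words_inside n A = {w. length w = n \<and> set w \<subseteq> {1..} \<and> cylinder w \<subseteq> A}"

lemma determined_by_cylinder: "determined_by (length w) (cylinder w)"
  by (auto simp: determined_by_def cylinder_def)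

lemma determined_eq_UN_cylinder:
  assumes "determined_by n A"
  shows "A = (\<Union>w\<in>words_inside n A. cylinder w)"
proof
  show "A \<subseteq> (\<Union>w\<in>words_inside n A. cylinder w)"
  proof
    fix x assume x: "x \<in> A"
    then have fs: "x \<in> full_shift" using assms by (auto simp: determined_by_def)
    have "cylinder (map x [0..<n]) \<subseteq> A"
      using assms x by (auto simp: determined_by_def cylinder_def)
    moreover have "set (map x [0..<n]) \<subseteq> {1..}" using fs by (auto simp: full_shift_def)
    moreover have "x \<in> cylinder (map x [0..<n])" using fs by (simp add: cylinder_def)
    ultimately show "x \<in> (\<Union>w\<in>words_inside n A. cylinder w)"
      by (intro UN_I[of "map x [0..<n]"]) (auto simp: words_inside_def)
  qed
qed (auto simp: words_inside_def)

lemma disjoint_cylinders: "disjoint_family_on cylinder (words_inside n A)"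
  unfolding disjoint_family_on_def words_inside_def cylinder_def
  by (auto simp: list_eq_iff_nth_eq)

lemma cylinder_append:
  "cylinder (u @ v) = cylinder u \<inter> preimage_shift (length u) (cylinder v)"
proof -
  have "(\<forall>i<length u + length v. x i = (u @ v) ! i) \<longleftrightarrow>
      (\<forall>i<length u. x i = u ! i) \<and> (\<forall>i<length v. x (i + length u) = v ! i)" for x
    by (auto simp: nth_append)
       (metis add.commute add_diff_inverse_nat nat_add_left_cancel_less)
  then show ?thesis
    by (auto simp: cylinder_def preimage_shift_def funpow_shift full_shift_def)
qed

lemma sets_cylinder: "cylinder w \<in> sets shift_space"
proof -
  have coord: "(\<lambda>x. x i) \<in> shift_space \<rightarrow>\<^sub>M count_space {1::nat..}" for i
    unfolding shift_space_def by (rule measurable_component_singleton) simp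
  have "(\<lambda>x. x i) \<in> shift_space \<rightarrow>\<^sub>M count_space UNIV" for i
    by (rule measurable_compose[OF coord, where g="\<lambda>n. n"]) simp
  note [measurable] = this
  have "cylinder w = {x \<in> space shift_space. \<forall>i\<in>{..<length w}. x i = w ! i}"
    by (auto simp: cylinder_def space_shift_space)
  also have "\<dots> \<in> sets shift_space" by measurable
  finally show ?thesis .
qed

lemma sets_determined_by:
  assumes "determined_by n A"
  shows "A \<in> sets shift_space"
  by (subst determined_eq_UN_cylinder[OF assms], rule sets.countable_UN'')
     (auto intro: sets_cylinder)

section \<open>Quasi-Bernoulli measures\<close>

text \<open>Besides the two-sided product bound, all cylinders are required to have positive measure; with
  this the support is the whole space and \<open>decay_rate\<close> below is less than 1.\<close>

locale quasi_bernoulli = prob_space \<mu> for \<mu> :: "(nat \<Rightarrow> nat) measure" +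
  fixes D :: real
  assumes sets_eq: "sets \<mu> = sets shift_space"
    and shift_invariant: "A \<in> sets \<mu> \<Longrightarrow> emeasure \<mu> (shift -` A \<inter> space \<mu>) = emeasure \<mu> A"
    and D_ge_1: "1 \<le> D"
    and prob_cylinder_pos: "set w \<subseteq> {1..} \<Longrightarrow> 0 < prob (cylinder w)"
    and prob_cylinder_append_le: "set u \<subseteq> {1..} \<Longrightarrow> set v \<subseteq> {1..} \<Longrightarrow>
      prob (cylinder (u @ v)) \<le> D * prob (cylinder u) * prob (cylinder v)"
    and prob_cylinder_append_ge: "set u \<subseteq> {1..} \<Longrightarrow> set v \<subseteq> {1..} \<Longrightarrow>
      prob (cylinder u) * prob (cylinder v) \<le> D * prob (cylinder (u @ v))"
begin

lemma space_eq: "space \<mu> = full_shift"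
  using sets_eq_imp_space_eq[OF sets_eq] by (simp add: space_shift_space)

lemma D_pos: "0 < D" using D_ge_1 by simp

lemma determined_in_sets: "determined_by n A \<Longrightarrow> A \<in> sets \<mu>"
  using sets_determined_by sets_eq by blast

lemma preimage_shift_invariant:
  assumes "A \<in> sets \<mu>"
  shows "preimage_shift n A \<in> sets \<mu> \<and> prob (preimage_shift n A) = prob A"
proof (induction n)
  case 0
  have "preimage_shift 0 A = A"
    using sets.sets_into_space[OF assms] by (simp add: preimage_shift_0 space_eq)
  then show ?case using assms by simp
next
  case (Suc n)
  have meas: "shift \<in> measurable \<mu> \<mu>"
  proof -
    have "shift \<in> measurable shift_space shift_space"
      unfolding shift_space_def shift_def
      by (rule measurable_PiM_single') (auto simp: space_PiM)
    then show ?thesis by (simp add: measurable_cong_sets[OF sets_eq sets_eq])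
  qed
  have eq: "preimage_shift (Suc n) A = shift -` (preimage_shift n A) \<inter> space \<mu>"
    by (auto simp: preimage_shift_def space_eq funpow_shift shift_def full_shift_def)
  show ?case
    unfolding eq using Suc measurable_sets[OF meas] shift_invariant
    by (auto simp: measure_def)
qed

lemma prob_compl_full_shift: "A \<in> sets \<mu> \<Longrightarrow> prob (full_shift - A) = 1 - prob A"
  using prob_compl by (simp add: space_eq)

text \<open>A set that depends on \<open>n\<close> coordinates is a countable disjoint union of cylinders; this is
  how bounds for cylinders pass to such sets.\<close>

lemma emeasure_Int_determined:
  assumes A: "determined_by n A" and B: "B \<in> sets \<mu>"
  shows "emeasure \<mu> (A \<inter> B) =
    (\<integral>\<^sup>+w. emeasure \<mu> (cylinder w \<inter> B) \<partial>count_space (words_inside n A))"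
proof -
  have "A \<inter> B = (\<Union>w\<in>words_inside n A. cylinder w \<inter> B)"
    using determined_eq_UN_cylinder[OF A] by blast
  moreover have "disjoint_family_on (\<lambda>w. cylinder w \<inter> B) (words_inside n A)"
    using disjoint_cylinders[of n A] unfolding disjoint_family_on_def by blast
  ultimately show ?thesis
    using B determined_in_sets[OF determined_by_cylinder]
    by (simp only:) (rule emeasure_UN_countable, auto)
qed

lemma emeasure_determined:
  assumes "determined_by n A"
  shows "emeasure \<mu> A = (\<integral>\<^sup>+w. emeasure \<mu> (cylinder w) \<partial>count_space (words_inside n A))"
  using emeasure_Int_determined[OF assms determined_in_sets[OF determined_by_full_shift]]
    determined_by_subset[OF assms] determined_by_subset[OF determined_by_cylinder]
  by (simp add: Int_absorb2)

lemma emeasure_cylinder_Int_preimage: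
  assumes B: "determined_by m B"
  shows "emeasure \<mu> (cylinder u \<inter> preimage_shift (length u) B) =
    (\<integral>\<^sup>+v. emeasure \<mu> (cylinder (u @ v)) \<partial>count_space (words_inside m B))"
proof -
  have "cylinder u \<inter> preimage_shift (length u) B = (\<Union>v\<in>words_inside m B. cylinder (u @ v))"
    unfolding cylinder_append
    by (subst determined_eq_UN_cylinder[OF B]) (auto simp: preimage_shift_def)
  moreover have "disjoint_family_on (\<lambda>v. cylinder (u @ v)) (words_inside m B)"
    using disjoint_cylinders[of m B] unfolding disjoint_family_on_def cylinder_append
    by (fastforce simp: preimage_shift_def)
  ultimately show ?thesis
    using determined_in_sets[OF determined_by_cylinder]
    by (simp only:) (rule emeasure_UN_countable, auto)
qed

text \<open>The product bounds, like the decomposition into cylinders, are summed first over the future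
  and then over the past.\<close>

lemma emeasure_Int_preimage_le:
  assumes A: "determined_by n A" and B: "determined_by m B"
  shows "emeasure \<mu> (A \<inter> preimage_shift n B) \<le> ennreal D * emeasure \<mu> A * emeasure \<mu> B"
proof -
  have *: "emeasure \<mu> (cylinder u \<inter> preimage_shift n B) \<le> ennreal D * emeasure \<mu> B * emeasure \<mu> (cylinder u)"
    if u: "u \<in> words_inside n A" for u
  proof -
    have un: "length u = n" "set u \<subseteq> {1..}" using u by (auto simp: words_inside_def)
    have "emeasure \<mu> (cylinder u \<inter> preimage_shift n B)
        \<le> (\<integral>\<^sup>+v. ennreal D * emeasure \<mu> (cylinder u) * emeasure \<mu> (cylinder v)
            \<partial>count_space (words_inside m B))"
      unfolding emeasure_cylinder_Int_preimage[OF B, of u, unfolded un]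
    proof (rule nn_integral_mono)
      fix v assume "v \<in> space (count_space (words_inside m B))"
      then have "set v \<subseteq> {1..}" by (auto simp: words_inside_def)
      then show "emeasure \<mu> (cylinder (u @ v)) \<le> ennreal D * emeasure \<mu> (cylinder u) * emeasure \<mu> (cylinder v)"
        using prob_cylinder_append_le[OF un(2)] D_pos
        by (simp add: emeasure_eq_measure ennreal_mult[symmetric])
    qed
    also have "\<dots> = ennreal D * emeasure \<mu> (cylinder u) * emeasure \<mu> B"
      by (simp add: nn_integral_cmult emeasure_determined[OF B])
    finally show ?thesis by (simp add: mult_ac)
  qed
  have "emeasure \<mu> (A \<inter> preimage_shift n B)
      = (\<integral>\<^sup>+u. emeasure \<mu> (cylinder u \<inter> preimage_shift n B) \<partial>count_space (words_inside n A))"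
    using preimage_shift_invariant[OF determined_in_sets[OF B]]
    by (intro emeasure_Int_determined[OF A]) simp
  also have "\<dots>
      \<le> (\<integral>\<^sup>+u. ennreal D * emeasure \<mu> B * emeasure \<mu> (cylinder u) \<partial>count_space (words_inside n A))"
    by (intro nn_integral_mono *) simp
  also have "\<dots> = ennreal D * emeasure \<mu> B * emeasure \<mu> A"
    by (simp add: nn_integral_cmult emeasure_determined[OF A])
  finally show ?thesis by (simp add: mult_ac)
qed

lemma prob_Int_preimage_le:
  assumes A: "determined_by n A" and B: "determined_by m B"
  shows "prob (A \<inter> preimage_shift n B) \<le> D * prob A * prob B"
  using emeasure_Int_preimage_le[OF A B] D_pos
  by (simp add: emeasure_eq_measure ennreal_mult[symmetric])

lemma emeasure_Int_preimage_ge: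
  assumes A: "determined_by n A" and B: "determined_by m B"
  shows "emeasure \<mu> A * emeasure \<mu> B \<le> ennreal D * emeasure \<mu> (A \<inter> preimage_shift n B)"
proof -
  have *: "emeasure \<mu> B * emeasure \<mu> (cylinder u) \<le> ennreal D * emeasure \<mu> (cylinder u \<inter> preimage_shift n B)"
    if u: "u \<in> words_inside n A" for u
  proof -
    have un: "length u = n" "set u \<subseteq> {1..}" using u by (auto simp: words_inside_def)
    have "emeasure \<mu> (cylinder u) * emeasure \<mu> B =
       (\<integral>\<^sup>+v. emeasure \<mu> (cylinder u) * emeasure \<mu> (cylinder v) \<partial>count_space (words_inside m B))"
      by (simp add: nn_integral_cmult emeasure_determined[OF B])
    also have "\<dots> \<le> (\<integral>\<^sup>+v. ennreal D * emeasure \<mu> (cylinder (u @ v)) \<partial>count_space (words_inside m B))"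
    proof (rule nn_integral_mono)
      fix v assume "v \<in> space (count_space (words_inside m B))"
      then have "set v \<subseteq> {1..}" by (auto simp: words_inside_def)
      then show "emeasure \<mu> (cylinder u) * emeasure \<mu> (cylinder v) \<le> ennreal D * emeasure \<mu> (cylinder (u @ v))"
        using prob_cylinder_append_ge[OF un(2)] D_pos
        by (simp add: emeasure_eq_measure ennreal_mult[symmetric])
    qed
    also have "\<dots> = ennreal D * (\<integral>\<^sup>+v. emeasure \<mu> (cylinder (u @ v)) \<partial>count_space (words_inside m B))"
      by (simp add: nn_integral_cmult)
    also have "(\<integral>\<^sup>+v. emeasure \<mu> (cylinder (u @ v)) \<partial>count_space (words_inside m B))
        = emeasure \<mu> (cylinder u \<inter> preimage_shift n B)"
      using emeasure_cylinder_Int_preimage[OF B, of u] un by simp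
    finally show ?thesis by (simp add: mult_ac)
  qed
  have "emeasure \<mu> B * emeasure \<mu> A =
      (\<integral>\<^sup>+u. emeasure \<mu> B * emeasure \<mu> (cylinder u) \<partial>count_space (words_inside n A))"
    by (simp add: nn_integral_cmult emeasure_determined[OF A])
  also have "\<dots> \<le> (\<integral>\<^sup>+u. ennreal D * emeasure \<mu> (cylinder u \<inter> preimage_shift n B) \<partial>count_space (words_inside n A))"
    by (intro nn_integral_mono *) simp
  also have "\<dots> = ennreal D * emeasure \<mu> (A \<inter> preimage_shift n B)"
    using preimage_shift_invariant[OF determined_in_sets[OF B]]
    by (simp add: nn_integral_cmult emeasure_Int_determined[OF A])
  finally show ?thesis by (simp add: mult_ac)
qed

lemma prob_Int_preimage_ge:
  assumes A: "determined_by n A" and B: "determined_by m B"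
  shows "prob A * prob B \<le> D * prob (A \<inter> preimage_shift n B)"
  using emeasure_Int_preimage_ge[OF A B] D_pos
  by (simp add: emeasure_eq_measure ennreal_mult[symmetric])

text \<open>Whatever has been observed during the first \<open>n\<close> steps, the event \<open>B\<close> still has conditional
  probability at least \<open>prob B / D\<close>. Bounding the complement through the lower product bound
  for \<open>B\<close> gives a factor less than 1, which the upper product bound, with its constant \<open>D \<ge> 1\<close>,
  cannot give.\<close>

lemma prob_Int_preimage_compl_le:
  assumes A: "determined_by n A" and B: "determined_by m B"
  shows "prob (A \<inter> preimage_shift n (full_shift - B)) \<le> prob A * (1 - prob B / D)"
proof -
  have sets: "A \<in> sets \<mu>" "preimage_shift n B \<in> sets \<mu>"
    using A B determined_in_sets preimage_shift_invariant by blast+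
  have "A \<inter> preimage_shift n (full_shift - B) = A - (A \<inter> preimage_shift n B)"
    using determined_by_subset[OF A] by (auto simp: preimage_shift_compl)
  then have "prob (A \<inter> preimage_shift n (full_shift - B)) = prob A - prob (A \<inter> preimage_shift n B)"
    using sets by (simp add: finite_measure_Diff)
  also have "\<dots> \<le> prob A - prob A * prob B / D"
    using prob_Int_preimage_ge[OF A B] D_pos by (simp add: field_simps)
  finally show ?thesis by (simp add: field_simps)
qed

section \<open>Rare returns and likely visits\<close>

text \<open>Given the past, the next symbol lies outside a set that misses 1 or 2 with probability at least
  \<open>1 - decay_rate\<close>.\<close>

definition decay_rate :: real where
  "decay_rate = 1 - min (prob (cylinder [1])) (prob (cylinder [2])) / D"

lemma decay_rate_less_1: "decay_rate < 1"
  using prob_cylinder_pos[of "[1]"] prob_cylinder_pos[of "[2]"] D_pos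
  by (simp add: decay_rate_def)

lemma decay_rate_nonneg: "0 \<le> decay_rate"
proof -
  have "min (prob (cylinder [1])) (prob (cylinder [2])) \<le> D"
    using prob_le_1[of "cylinder [1]"] D_ge_1 by linarith
  then show ?thesis using D_pos by (simp add: decay_rate_def)
qed

text \<open>One factor \<open>decay_rate\<close> for each coordinate, since the sequences that start with a symbol
  outside \<open>S i\<close> include the whole cylinder \<open>[1]\<close> or \<open>[2]\<close>.\<close>

lemma prob_box_le:
  assumes "\<And>i. i < n \<Longrightarrow> 1 \<notin> S i \<or> 2 \<notin> S i"
  shows "prob (box n S) \<le> decay_rate ^ n"
  using assms
proof (induction n)
  case 0
  then show ?case by simp
next
  case (Suc n)
  define B where "B = {x \<in> full_shift. x 0 \<notin> S n}"
  have B: "determined_by 1 B" by (auto simp: determined_by_def B_def)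
  have "box (Suc n) S = box n S \<inter> preimage_shift n (full_shift - B)"
    by (auto simp: box_def preimage_shift_def B_def funpow_shift less_Suc_eq full_shift_def)
  then have "prob (box (Suc n) S) \<le> prob (box n S) * (1 - prob B / D)"
    using prob_Int_preimage_compl_le[OF determined_by_box B] by simp
  also have "\<dots> \<le> prob (box n S) * decay_rate"
  proof (rule mult_left_mono)
    have "cylinder [1] \<subseteq> B \<or> cylinder [2] \<subseteq> B"
      using Suc.prems[of n] by (auto simp: cylinder_def B_def)
    then have "prob (cylinder [1]) \<le> prob B \<or> prob (cylinder [2]) \<le> prob B"
      using finite_measure_mono determined_in_sets[OF B] by blast
    then have "min (prob (cylinder [1])) (prob (cylinder [2])) \<le> prob B" by linarith
    then show "1 - prob B / D \<le> decay_rate"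
      using D_pos by (simp add: decay_rate_def divide_right_mono)
  qed simp
  also have "\<dots> \<le> decay_rate ^ n * decay_rate"
    using Suc by (intro mult_right_mono decay_rate_nonneg) simp
  finally show ?case by (simp add: mult_ac)
qed

text \<open>A window for visits to a set that depends on \<open>k\<close> coordinates overhangs by \<open>k\<close>. This bound shows
  that the overhang is at most comparable to the reciprocal of the measure of the set.\<close>

lemma depth_times_prob_box_le:
  assumes "\<And>i. i < k \<Longrightarrow> 1 \<notin> S i \<or> 2 \<notin> S i"
  shows "real k * prob (box k S) \<le> 1 / (1 - decay_rate)"
proof -
  have "real k * prob (box k S) \<le> real k * decay_rate ^ k"
    by (intro mult_left_mono prob_box_le assms) auto
  also have "\<dots> = (\<Sum>i<k. decay_rate ^ k)" by simp
  also have "\<dots> \<le> (\<Sum>i<k. decay_rate ^ i)"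
    using decay_rate_nonneg decay_rate_less_1 by (intro sum_mono power_decreasing) auto
  also have "\<dots> \<le> 1 / (1 - decay_rate)"
    using decay_rate_nonneg decay_rate_less_1 zero_le_power[OF decay_rate_nonneg, of k]
    by (subst sum_gp_strict) (simp add: divide_right_mono)
  finally show ?thesis .
qed

text \<open>For \<open>j < k\<close> the occurrences of \<open>B\<close> at times 0 and \<open>j\<close> overlap. The second one is then kept in full,
  while of the first one only the first \<open>j\<close> coordinates are used, which lie in a box. For \<open>j \<ge> k\<close>
  there is no overlap and the product bound applies.\<close>

lemma prob_return_le:
  assumes B: "determined_by k B" and box: "B \<subseteq> box k S"
    and S: "\<And>i. i < k \<Longrightarrow> 1 \<notin> S i \<or> 2 \<notin> S i"
  shows "prob (B \<inter> preimage_shift j B) \<le> D * (decay_rate ^ j + prob B) * prob B"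
proof (cases "j < k")
  case True
  have sets: "B \<in> sets \<mu>" "preimage_shift j B \<in> sets \<mu>" "box j S \<in> sets \<mu>"
    using determined_in_sets[OF B] preimage_shift_invariant determined_in_sets[OF determined_by_box]
    by blast+
  have "B \<inter> preimage_shift j B \<subseteq> box j S \<inter> preimage_shift j B"
    using box True by (force simp: box_def)
  then have "prob (B \<inter> preimage_shift j B) \<le> prob (box j S \<inter> preimage_shift j B)"
    by (rule finite_measure_mono) (use sets in blast)
  also have "\<dots> \<le> D * prob (box j S) * prob B"
    by (intro prob_Int_preimage_le[OF _ B] determined_by_box)
  also have "\<dots> \<le> D * (decay_rate ^ j + prob B) * prob B"
    using D_pos prob_box_le[of j S] S True
    by (intro mult_right_mono mult_left_mono) (auto intro: add_increasing2)
  finally show ?thesis .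
next
  case False
  have "prob (B \<inter> preimage_shift j B) \<le> D * prob B * prob B"
    using False by (intro prob_Int_preimage_le[OF _ B] determined_by_mono[OF B]) simp
  also have "\<dots> \<le> D * (decay_rate ^ j + prob B) * prob B"
    using D_pos decay_rate_nonneg by (intro mult_right_mono mult_left_mono) auto
  finally show ?thesis .
qed

text \<open>The reciprocal of a bound for the quotient of the second and the first moment of the number of
  visits to a set \<open>B\<close> during a window of length about \<open>1 / prob B\<close>: returns after short times contribute
  the geometric series, later ones at most the expected number 2 of visits, the factor 2 counts both
  orders of a pair and \<open>D\<close> stands for the dependence.\<close>

definition hit_prob :: real where
  "hit_prob = 1 / (2 * D * (1 / (1 - decay_rate) + 2))"

lemma hit_prob_pos: "0 < hit_prob"
  using decay_rate_less_1 D_pos by (simp add: hit_prob_def add_pos_pos)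

text \<open>For the number \<open>N\<close> of events that occur, the indicator of \<open>N > 0\<close> is at least \<open>1 - (1 - N/a)\<^sup>2\<close>. With \<open>a\<close>
  the quotient of the second and the first moment this is the Paley--Zygmund bound; a free \<open>a\<close>
  permits the use of an upper bound for that quotient.\<close>

lemma prob_UN_second_moment:
  fixes H :: "nat \<Rightarrow> (nat \<Rightarrow> nat) set"
  assumes H: "\<And>t. t < L \<Longrightarrow> H t \<in> sets \<mu>" and a: "0 < a"
  shows "2 / a * (\<Sum>t<L. prob (H t)) - 1 / a\<^sup>2 * (\<Sum>s<L. \<Sum>t<L. prob (H s \<inter> H t))
     \<le> prob (\<Union>t<L. H t)"
proof -
  let ?N = "\<lambda>x. \<Sum>t<L. indicat_real (H t) x"
  let ?U = "\<Union>t<L. H t"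
  have sq: "(\<Sum>s<L. \<Sum>t<L. indicat_real (H s \<inter> H t) x) = (?N x)\<^sup>2" for x
    by (simp add: power2_eq_square sum_product indicator_inter_arith)
  have int: "integrable \<mu> ?N" "integrable \<mu> (\<lambda>x. \<Sum>s<L. \<Sum>t<L. indicat_real (H s \<inter> H t) x)"
    using H by (auto simp: emeasure_eq_measure intro!: Bochner_Integration.integrable_sum)
  have "expectation ?N = (\<Sum>t<L. prob (H t))"
    using H by (subst Bochner_Integration.integral_sum) (auto simp: emeasure_eq_measure)
  moreover have "expectation (\<lambda>x. \<Sum>s<L. \<Sum>t<L. indicat_real (H s \<inter> H t) x)
      = (\<Sum>s<L. \<Sum>t<L. prob (H s \<inter> H t))"
    using H by (subst Bochner_Integration.integral_sum,
        force simp: emeasure_eq_measure intro!: Bochner_Integration.integrable_sum)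
      (intro sum.cong refl, subst Bochner_Integration.integral_sum, auto simp: emeasure_eq_measure)
  ultimately have "2 / a * (\<Sum>t<L. prob (H t)) - 1 / a\<^sup>2 * (\<Sum>s<L. \<Sum>t<L. prob (H s \<inter> H t))
      = expectation (\<lambda>x. 2 / a * ?N x - 1 / a\<^sup>2 * (\<Sum>s<L. \<Sum>t<L. indicat_real (H s \<inter> H t) x))"
    using int by simp
  also have "\<dots> \<le> expectation (indicat_real ?U)"
  proof (rule integral_mono)
    show "integrable \<mu> (\<lambda>x. 2 / a * ?N x - 1 / a\<^sup>2 * (\<Sum>s<L. \<Sum>t<L. indicat_real (H s \<inter> H t) x))"
      using int by (intro Bochner_Integration.integrable_diff integrable_mult_right)
    show "integrable \<mu> (indicat_real ?U)"
      using H by (auto simp: emeasure_eq_measure)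
    fix x
    show "2 / a * ?N x - 1 / a\<^sup>2 * (\<Sum>s<L. \<Sum>t<L. indicat_real (H s \<inter> H t) x) \<le> indicat_real ?U x"
    proof (cases "x \<in> ?U")
      case True
      have "0 \<le> (1 - ?N x / a)\<^sup>2" by simp
      also have "\<dots> = 1 - (2 / a * ?N x - 1 / a\<^sup>2 * (?N x)\<^sup>2)"
        by (simp add: power2_diff power_divide)
      finally show ?thesis using True unfolding sq by simp
    next
      case False
      then have "?N x = 0" by (intro sum.neutral) auto
      then show ?thesis using False unfolding sq by simp
    qed
  qed
  also have "\<dots> = prob ?U" using H by auto
  finally show ?thesis .
qed

text \<open>The second moment bound needs an expected number of visits of order 1, so it is applied to a
  window of length about \<open>1 / prob B\<close>, which may be shorter than \<open>L\<close>.\<close>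

lemma prob_hit_ge:
  assumes B: "determined_by k B" and box: "B \<subseteq> box k S"
    and S: "\<And>i. i < k \<Longrightarrow> 1 \<notin> S i \<or> 2 \<notin> S i"
    and L: "1 \<le> real L * prob B"
  shows "hit_prob \<le> prob (\<Union>t<L. preimage_shift t B)"
proof -
  let ?H = "\<lambda>t. preimage_shift t B" and ?\<rho> = decay_rate
  have Bs: "B \<in> sets \<mu>" by (rule determined_in_sets[OF B])
  have Hs: "?H t \<in> sets \<mu>" and pH: "prob (?H t) = prob B" for t
    using preimage_shift_invariant[OF Bs] by auto
  have pB: "0 < prob B"
    using L measure_nonneg[of \<mu> B] by (cases "prob B = 0") (auto simp: less_le)
  \<comment> \<open>With this length the expected number of visits lies between 1 and 2.\<close>
  define M where "M = nat \<lceil>1 / prob B\<rceil>"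
  have "1 / prob B \<le> real M" unfolding M_def by (rule real_nat_ceiling_ge)
  then have M1: "1 \<le> real M * prob B" using pB by (simp add: field_simps)
  have M2: "real M * prob B \<le> 2"
  proof -
    have "real M \<le> 1 / prob B + 1"
      using pB by (simp add: M_def of_nat_nat ceiling_correct)
    then have "real M * prob B \<le> (1 / prob B + 1) * prob B"
      using pB by (intro mult_right_mono) auto
    also have "\<dots> = 1 + prob B" using pB by (simp add: field_simps)
    finally show ?thesis using prob_le_1[of B] by linarith
  qed
  have M_le_L: "M \<le> L"
    using L pB by (simp add: M_def nat_le_iff ceiling_le_iff field_simps)
  let ?f = "\<lambda>j. D * (?\<rho> ^ j + prob B) * prob B"
  have f_nonneg: "0 \<le> ?f j" for j
    using D_pos decay_rate_nonneg by simp
  \<comment> \<open>By invariance, a pair of visits counts as a return after the time between them.\<close>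
  have pair: "prob (?H s \<inter> ?H t) \<le> ?f (t - s)" if "s \<le> t" for s t
  proof -
    have "?H s \<inter> ?H t = preimage_shift s (B \<inter> preimage_shift (t - s) B)"
      using that by (simp add: preimage_shift_Int preimage_shift_preimage_shift)
    moreover have "B \<inter> preimage_shift (t - s) B \<in> sets \<mu>"
      using Bs Hs by blast
    ultimately have "prob (?H s \<inter> ?H t) = prob (B \<inter> preimage_shift (t - s) B)"
      using preimage_shift_invariant by simp
    then show ?thesis using prob_return_le[OF B box S] by simp
  qed
  have total: "(\<Sum>j<M. ?f j) \<le> D * prob B * (1 / (1 - ?\<rho>) + 2)"
  proof -
    have "(\<Sum>j<M. ?f j) = (\<Sum>j<M. D * prob B * ?\<rho> ^ j + D * prob B * prob B)"
      by (intro sum.cong refl) (simp add: algebra_simps)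
    also have "\<dots> = D * prob B * ((\<Sum>j<M. ?\<rho> ^ j) + real M * prob B)"
      by (simp add: sum.distrib sum_distrib_left[symmetric] distrib_left)
    also have "\<dots> \<le> D * prob B * (1 / (1 - ?\<rho>) + 2)"
    proof -
      have "(\<Sum>j<M. ?\<rho> ^ j) \<le> 1 / (1 - ?\<rho>)"
        using decay_rate_less_1 zero_le_power[OF decay_rate_nonneg, of M]
        by (subst sum_gp_strict) (simp add: divide_right_mono)
      then show ?thesis
        using M2 D_pos by (intro mult_left_mono add_mono) auto
    qed
    finally show ?thesis .
  qed
  define Q where "Q = 2 * D * (1 / (1 - ?\<rho>) + 2)"
  have hit_Q: "hit_prob = 1 / Q" by (simp add: hit_prob_def Q_def)
  then have Q: "0 < Q" using hit_prob_pos by simp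
  \<comment> \<open>Each time difference occurs at most twice, before and after \<open>s\<close>.\<close>
  have row: "(\<Sum>t<M. prob (?H s \<inter> ?H t)) \<le> prob B * Q" if "s < M" for s
  proof -
    have "{..<M} = {..<s} \<union> {s..<M}" using that by auto
    then have "(\<Sum>t<M. prob (?H s \<inter> ?H t)) =
        (\<Sum>t<s. prob (?H s \<inter> ?H t)) + (\<Sum>t\<in>{s..<M}. prob (?H s \<inter> ?H t))"
      by (simp add: sum.union_disjoint ivl_disj_int)
    also have "\<dots> \<le> (\<Sum>t<s. ?f (s - t)) + (\<Sum>t\<in>{s..<M}. ?f (t - s))"
      using pair[of _ s] pair[of s] by (intro add_mono sum_mono) (auto simp: Int_commute)
    also have "(\<Sum>t<s. ?f (s - t)) = (\<Sum>j\<in>{1..s}. ?f j)"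
      by (rule sum.reindex_bij_witness[of _ "\<lambda>j. s - j" "\<lambda>t. s - t"]) auto
    also have "\<dots> \<le> (\<Sum>j<M. ?f j)"
      using that by (intro sum_mono2 f_nonneg) auto
    also have "(\<Sum>t\<in>{s..<M}. ?f (t - s)) = (\<Sum>j<M - s. ?f j)"
      by (rule sum.reindex_bij_witness[of _ "\<lambda>j. j + s" "\<lambda>t. t - s"]) auto
    also have "\<dots> \<le> (\<Sum>j<M. ?f j)"
      by (intro sum_mono2 f_nonneg) auto
    finally have "(\<Sum>t<M. prob (?H s \<inter> ?H t)) \<le> 2 * (\<Sum>j<M. ?f j)" by simp
    also have "\<dots> \<le> 2 * (D * prob B * (1 / (1 - ?\<rho>) + 2))"
      by (rule mult_left_mono[OF total]) simp
    also have "\<dots> = prob B * Q" by (simp add: Q_def)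
    finally show ?thesis .
  qed
  have "(\<Sum>s<M. \<Sum>t<M. prob (?H s \<inter> ?H t)) \<le> (\<Sum>s<M. prob B * Q)"
    by (intro sum_mono row) simp
  then have second: "(\<Sum>s<M. \<Sum>t<M. prob (?H s \<inter> ?H t)) \<le> (real M * prob B) * Q" by simp
  have "hit_prob \<le> real M * prob B / Q"
    using M1 Q unfolding hit_Q by (intro divide_right_mono) auto
  also have "\<dots> = 2 / Q * (real M * prob B) - 1 / Q\<^sup>2 * ((real M * prob B) * Q)"
    using Q by (simp add: power2_eq_square)
  also have "\<dots> \<le> 2 / Q * (\<Sum>t<M. prob (?H t)) - 1 / Q\<^sup>2 * (\<Sum>s<M. \<Sum>t<M. prob (?H s \<inter> ?H t))"
    using second Q by (intro diff_mono mult_left_mono) (auto simp: pH)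
  also have "\<dots> \<le> prob (\<Union>t<M. ?H t)"
    by (rule prob_UN_second_moment[OF Hs Q])
  also have "\<dots> \<le> prob (\<Union>t<L. ?H t)"
    using Hs M_le_L by (intro finite_measure_mono UN_mono) auto
  finally show ?thesis .
qed

section \<open>Time to collect visits to finitely many sets\<close>

text \<open>In the application \<open>U\<close> is the event that a given set is visited within a window, and \<open>T\<close> is the
  length of the window together with its overhang, so that \<open>U\<close> depends on \<open>T\<close> coordinates.\<close>

definition avoid :: "nat \<Rightarrow> (nat \<Rightarrow> nat) set \<Rightarrow> nat \<Rightarrow> (nat \<Rightarrow> nat) set" where
  "avoid T U n = {x \<in> full_shift. \<forall>j<n. (shift ^^ (j * T)) x \<notin> U}"

lemma avoid_Suc: "avoid T U (Suc n) = avoid T U n \<inter> preimage_shift (n * T) (full_shift - U)"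
  by (auto simp: avoid_def preimage_shift_def less_Suc_eq funpow_shift_in_full_shift)

lemma determined_by_avoid:
  assumes "determined_by T U"
  shows "determined_by (n * T) (avoid T U n)"
proof (induction n)
  case 0
  then show ?case by (simp add: avoid_def determined_by_def)
next
  case (Suc n)
  then show ?case
    unfolding avoid_Suc
    using determined_by_preimage_shift[OF determined_by_compl[OF assms], of "n * T"]
    by (intro determined_by_Int) (auto elim: determined_by_mono simp: add.commute)
qed

lemma prob_avoid_le:
  assumes "determined_by T U"
  shows "prob (avoid T U n) \<le> (1 - prob U / D) ^ n"
proof (induction n)
  case 0
  then show ?case by simp
next
  case (Suc n)
  have "prob U \<le> D" using prob_le_1[of U] D_ge_1 by linarith
  then have "0 \<le> 1 - prob U / D" using D_pos by simp
  then have "prob (avoid T U n) * (1 - prob U / D) \<le> (1 - prob U / D) ^ n * (1 - prob U / D)"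
    by (rule mult_right_mono[OF Suc])
  then show ?case
    using prob_Int_preimage_compl_le[OF determined_by_avoid[OF assms, of n] assms]
    unfolding avoid_Suc by (simp add: mult_ac)
qed

text \<open>A coupon collector bound. The probability that some \<open>U r\<close> has been missed \<open>n\<close> times is at
  most \<open>card I * (1 - p / D) ^ n\<close>. This is less than 1 only after about \<open>(D / p) ln (card I)\<close> rounds;
  before that it is bounded by 1, after that it is summed as a geometric series.\<close>

lemma nn_integral_collection_time_le:
  fixes f :: "(nat \<Rightarrow> nat) \<Rightarrow> ennreal"
  assumes I: "finite I" "I \<noteq> {}"
    and U: "\<And>r. r \<in> I \<Longrightarrow> determined_by T (U r)"
    and p: "0 < p" "\<And>r. r \<in> I \<Longrightarrow> p \<le> prob (U r)"
    and T: "1 \<le> T"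
    and f: "\<And>x n. x \<in> full_shift \<Longrightarrow> (\<And>r. r \<in> I \<Longrightarrow> x \<notin> avoid T (U r) n) \<Longrightarrow> f x \<le> of_nat (n * T)"
  shows "(\<integral>\<^sup>+x. f x \<partial>\<mu>) \<le> ennreal (real T * (D / p * ln (real (card I)) + D / p + 1))"
proof -
  define q where "q = p / D"
  define R where "R = real (card I)"
  define n0 where "n0 = nat \<lceil>ln R / q\<rceil>"
  have q0: "0 < q" using p D_pos by (simp add: q_def)
  have R1: "1 \<le> R" using I by (simp add: R_def Suc_le_eq card_gt_0_iff)
  have q1: "q \<le> 1"
  proof -
    obtain r where "r \<in> I" using I by blast
    then have "p \<le> D" using p(2)[of r] prob_le_1[of "U r"] D_ge_1 by linarith
    then show ?thesis using D_pos by (simp add: q_def)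
  qed
  have avoid_sets: "avoid T (U r) n \<in> sets \<mu>" if "r \<in> I" for r n
    by (rule determined_in_sets[OF determined_by_avoid[OF U[OF that]]])
  have avoid_le: "prob (avoid T (U r) n) \<le> (1 - q) ^ n" if r: "r \<in> I" for r n
  proof -
    have "prob (U r) \<le> D" using prob_le_1[of "U r"] D_ge_1 by linarith
    then have "(1 - prob (U r) / D) ^ n \<le> (1 - q) ^ n"
      using p(2)[OF r] D_pos unfolding q_def
      by (intro power_mono) (auto simp: divide_right_mono)
    then show ?thesis using prob_avoid_le[OF U[OF r], of n] by linarith
  qed
  \<comment> \<open>The number of rounds is bounded by \<open>n0\<close> plus the number of later rounds before which some set is
    still missed; the sum over \<open>r\<close> is the union bound.\<close>
  let ?h = "\<lambda>m x. \<Sum>r\<in>I. indicator (avoid T (U r) (n0 + m)) x :: ennreal"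
  let ?g = "\<lambda>x. of_nat T * (of_nat n0 + (\<Sum>m. ?h m x))"
  have uncovered: "of_nat (N * T) \<le> ?g x"
    if x: "\<And>n. n < N \<Longrightarrow> \<exists>r\<in>I. x \<in> avoid T (U r) n" for x N
  proof -
    have "of_nat (N - n0) \<le> (\<Sum>m. ?h m x)"
    proof -
      have "1 \<le> ?h m x" if "m < N - n0" for m
      proof -
        have "n0 + m < N" using that by simp
        then obtain r where r: "r \<in> I" "x \<in> avoid T (U r) (n0 + m)"
          using x by blast
        then have "1 = (indicator (avoid T (U r) (n0 + m)) x :: ennreal)" by simp
        also have "\<dots> \<le> ?h m x" using I r by (intro member_le_sum) auto
        finally show ?thesis .
      qed
      then have "(\<Sum>m<N - n0. 1) \<le> (\<Sum>m<N - n0. ?h m x)" by (intro sum_mono) auto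
      also have "\<dots> \<le> (\<Sum>m. ?h m x)" by (intro sum_le_suminf) auto
      finally show ?thesis by simp
    qed
    then have "(of_nat n0 + of_nat (N - n0) :: ennreal) \<le> of_nat n0 + (\<Sum>m. ?h m x)"
      by (intro add_left_mono)
    moreover have "(of_nat N :: ennreal) \<le> of_nat n0 + of_nat (N - n0)"
      by (simp add: of_nat_add[symmetric] del: of_nat_add)
    ultimately have "(of_nat N :: ennreal) \<le> of_nat n0 + (\<Sum>m. ?h m x)" by (rule order_trans[rotated])
    then show ?thesis by (simp add: mult_left_mono mult.commute[of "of_nat N"])
  qed
  have "f x \<le> ?g x" if x: "x \<in> full_shift" for x
  proof (cases "\<exists>n. \<forall>r\<in>I. x \<notin> avoid T (U r) n")
    case True
    define N where "N = (LEAST n. \<forall>r\<in>I. x \<notin> avoid T (U r) n)"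
    have "\<forall>r\<in>I. x \<notin> avoid T (U r) N"
      unfolding N_def by (rule LeastI_ex[OF True])
    then have "f x \<le> of_nat (N * T)" by (intro f x) auto
    also have "\<dots> \<le> ?g x"
      by (rule uncovered) (use not_less_Least N_def in blast)
    finally show ?thesis .
  next
    case False
    \<comment> \<open>Some set is missed forever, and the majorant is infinite.\<close>
    have "of_nat N \<le> ?g x" for N
    proof -
      have "(of_nat N :: ennreal) \<le> of_nat (N * T)" using T by (intro of_nat_mono) simp
      also have "\<dots> \<le> ?g x" using False by (intro uncovered) auto
      finally show ?thesis .
    qed
    then have "?g x = top"
      using ennreal_Ex_less_of_nat[of "?g x"] by (meson leD top.not_eq_extremum)
    then show ?thesis by simp
  qed
  then have "(\<integral>\<^sup>+x. f x \<partial>\<mu>) \<le> (\<integral>\<^sup>+x. ?g x \<partial>\<mu>)"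
    by (intro nn_integral_mono) (simp add: space_eq)
  also have "\<dots> = of_nat T * (of_nat n0 + (\<Sum>m. \<Sum>r\<in>I. emeasure \<mu> (avoid T (U r) (n0 + m))))"
    using avoid_sets
    by (simp add: nn_integral_cmult nn_integral_add nn_integral_suminf nn_integral_sum emeasure_space_1)
  also have "\<dots> \<le> of_nat T * (of_nat n0 + ennreal (1 / q))"
  proof (intro mult_left_mono add_left_mono)
    \<comment> \<open>\<open>n0\<close> is chosen such that the union bound becomes effective there.\<close>
    have small: "R * (1 - q) ^ n0 \<le> 1"
    proof -
      have "ln R / q \<le> real n0" unfolding n0_def by (rule real_nat_ceiling_ge)
      then have "ln R \<le> q * real n0" using q0 by (simp add: field_simps)
      then have "R \<le> exp (q * real n0)" using R1 by (metis exp_le_cancel_iff exp_ln less_le_trans zero_less_one)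
      moreover have "(1 - q) ^ n0 \<le> exp (- q) ^ n0"
        using exp_ge_add_one_self[of "- q"] q1 by (intro power_mono) auto
      then have "(1 - q) ^ n0 \<le> exp (- (q * real n0))"
        by (simp add: exp_of_nat_mult[symmetric] mult.commute)
      ultimately have "R * (1 - q) ^ n0 \<le> exp (q * real n0) * exp (- (q * real n0))"
        using R1 q1 by (intro mult_mono) auto
      then show ?thesis by (simp add: exp_minus)
    qed
    have sums: "(\<lambda>m. (R * (1 - q) ^ n0) * (1 - q) ^ m) sums ((R * (1 - q) ^ n0) * (1 / (1 - (1 - q))))"
      using q0 q1 by (intro sums_mult geometric_sums) auto
    have "(\<Sum>m. \<Sum>r\<in>I. emeasure \<mu> (avoid T (U r) (n0 + m)))
        \<le> (\<Sum>m. ennreal ((R * (1 - q) ^ n0) * (1 - q) ^ m))"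
    proof (rule suminf_le)
      fix m
      have "(\<Sum>r\<in>I. prob (avoid T (U r) (n0 + m))) \<le> (\<Sum>r\<in>I. (1 - q) ^ (n0 + m))"
        by (intro sum_mono avoid_le)
      also have "\<dots> = (R * (1 - q) ^ n0) * (1 - q) ^ m" by (simp add: R_def power_add)
      finally show "(\<Sum>r\<in>I. emeasure \<mu> (avoid T (U r) (n0 + m))) \<le> ennreal ((R * (1 - q) ^ n0) * (1 - q) ^ m)"
        by (simp add: emeasure_eq_measure sum_ennreal ennreal_leI)
    qed auto
    also have "\<dots> = ennreal ((R * (1 - q) ^ n0) * (1 / (1 - (1 - q))))"
      using q1 R1 by (intro suminf_ennreal_eq sums) auto
    also have "\<dots> \<le> ennreal (1 / q)"
      using small q0 by (intro ennreal_leI) (simp add: divide_right_mono)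
    finally show "(\<Sum>m. \<Sum>r\<in>I. emeasure \<mu> (avoid T (U r) (n0 + m))) \<le> ennreal (1 / q)" .
  qed auto
  also have "\<dots> = ennreal (real T * (real n0 + 1 / q))"
    using q0 by (simp add: ennreal_mult ennreal_plus ennreal_of_nat_eq_real_of_nat)
  also have "\<dots> \<le> ennreal (real T * (D / p * ln (real (card I)) + D / p + 1))"
  proof (intro ennreal_leI mult_left_mono)
    have "0 \<le> ln R / q" using R1 q0 by simp
    then have "real n0 \<le> ln R / q + 1" unfolding n0_def by linarith
    then show "real n0 + 1 / q \<le> D / p * ln (real (card I)) + D / p + 1"
      by (simp add: q_def R_def mult.commute)
  qed simp
  finally show ?thesis .
qed

end

section \<open>The metric and its truncations\<close>

definition trunc_dist :: "real \<Rightarrow> nat \<Rightarrow> (nat \<Rightarrow> nat) \<Rightarrow> (nat \<Rightarrow> nat) \<Rightarrow> real" where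
  "trunc_dist \<theta> k x y = (\<Sum>i<k. \<theta> ^ i * \<bar>1 / real (x i) - 1 / real (y i)\<bar>)"

lemma abs_inverse_nat_diff_le_1: "\<bar>1 / real m - 1 / real n\<bar> \<le> 1"
proof -
  have "0 \<le> 1 / real k \<and> 1 / real k \<le> 1" for k :: nat by (cases k) auto
  from this[of m] this[of n] show ?thesis by linarith
qed

lemma sum_power_le:
  fixes \<theta> :: real
  assumes "0 < \<theta>" "\<theta> < 1"
  shows "(\<Sum>i<k. \<theta> ^ i) \<le> 1 / (1 - \<theta>)"
  using assms by (subst sum_gp_strict) (simp add: divide_right_mono)

lemma trunc_dist_le_d1:
  assumes "0 < \<theta>" "\<theta> < 1"
  shows "trunc_dist \<theta> k x y \<le> d1 \<theta> x y"
  unfolding trunc_dist_def d1_def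
  using assms by (intro sum_le_suminf summable_d1) auto

lemma d1_le_trunc_dist:
  assumes "0 < \<theta>" "\<theta> < 1"
  shows "d1 \<theta> x y \<le> trunc_dist \<theta> k x y + \<theta> ^ k / (1 - \<theta>)"
proof -
  let ?f = "\<lambda>n. \<theta> ^ n * \<bar>1 / real (x n) - 1 / real (y n)\<bar>"
  have sm: "summable ?f" by (rule summable_d1[OF assms])
  have "(\<Sum>n. ?f (n + k)) \<le> (\<Sum>n. \<theta> ^ k * \<theta> ^ n)"
  proof (rule suminf_le)
    show "?f (n + k) \<le> \<theta> ^ k * \<theta> ^ n" for n
      using assms abs_inverse_nat_diff_le_1[of "x (n + k)" "y (n + k)"]
      by (simp add: power_add mult.commute[of "\<theta> ^ n"] mult_left_le)
    show "summable (\<lambda>n. ?f (n + k))" by (rule summable_ignore_initial_segment[OF sm])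
    show "summable (\<lambda>n. \<theta> ^ k * \<theta> ^ n)" using assms by (intro summable_mult summable_geometric) auto
  qed
  also have "\<dots> = \<theta> ^ k / (1 - \<theta>)"
    using assms by (subst suminf_mult) (auto simp: suminf_geometric summable_geometric)
  finally show ?thesis
    unfolding d1_def trunc_dist_def using suminf_split_initial_segment[OF sm, of k] by simp
qed

lemma trunc_dist_commute: "trunc_dist \<theta> k x y = trunc_dist \<theta> k y x"
  by (simp add: trunc_dist_def abs_minus_commute)

lemma trunc_dist_triangle:
  assumes "0 < \<theta>"
  shows "trunc_dist \<theta> k x z \<le> trunc_dist \<theta> k x y + trunc_dist \<theta> k y z"
proof -
  have "\<theta> ^ i * \<bar>1 / real (x i) - 1 / real (z i)\<bar> \<le>
      \<theta> ^ i * \<bar>1 / real (x i) - 1 / real (y i)\<bar> + \<theta> ^ i * \<bar>1 / real (y i) - 1 / real (z i)\<bar>" for i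
    unfolding distrib_left[symmetric] using assms by (intro mult_left_mono) auto
  then show ?thesis
    unfolding trunc_dist_def sum.distrib[symmetric] by (intro sum_mono)
qed

text \<open>These sets stand in for balls of the metric because they depend on finitely many coordinates.
  They are deliberately not products of sets of symbols: a product set that contains a ball of
  radius \<open>\<epsilon>\<delta>\<close> may have a diameter of order \<open>k\<delta>\<close>, too large for a cover at scale \<open>\<delta>\<close>.\<close>

definition trunc_ball :: "real \<Rightarrow> nat \<Rightarrow> real \<Rightarrow> (nat \<Rightarrow> nat) \<Rightarrow> (nat \<Rightarrow> nat) set" where
  "trunc_ball \<theta> k r x = {y \<in> full_shift. trunc_dist \<theta> k x y \<le> r}"

lemma determined_by_trunc_ball: "determined_by k (trunc_ball \<theta> k r x)"
  by (auto simp: determined_by_def trunc_ball_def trunc_dist_def)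

lemma cylinder_subset_trunc_ball:
  "0 \<le> r \<Longrightarrow> cylinder (map x [0..<k]) \<subseteq> trunc_ball \<theta> k r x"
  by (auto simp: cylinder_def trunc_ball_def trunc_dist_def)

lemma mball_subset_trunc_ball:
  assumes "0 < \<theta>" "\<theta> < 1"
  shows "Metric_space.mball full_shift (d1 \<theta>) x r \<subseteq> trunc_ball \<theta> k r x"
proof
  fix y assume "y \<in> Metric_space.mball full_shift (d1 \<theta>) x r"
  then show "y \<in> trunc_ball \<theta> k r x"
    using trunc_dist_le_d1[OF assms, of k x y]
    by (simp add: Metric_space.in_mball[OF Metric_space_d1[OF assms]] trunc_ball_def)
qed

text \<open>The \<open>i\<close>th coordinate contributes to the distance with weight \<open>\<theta> ^ i\<close>, so a radius of at most \<open>\<theta> ^ i / 8\<close>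
  still restricts it.\<close>

lemma trunc_ball_subset_box:
  assumes "0 < \<theta>" and "\<And>i. i < k \<Longrightarrow> r \<le> \<theta> ^ i / 8"
  shows "trunc_ball \<theta> k r x \<subseteq> box k (\<lambda>i. {b. \<bar>1 / real (x i) - 1 / real b\<bar> \<le> 1 / 8})"
proof (clarsimp simp: trunc_ball_def box_def)
  fix y i assume y: "trunc_dist \<theta> k x y \<le> r" and i: "i < k"
  have "\<theta> ^ i * \<bar>1 / real (x i) - 1 / real (y i)\<bar> \<le> trunc_dist \<theta> k x y"
    unfolding trunc_dist_def using i assms(1) by (intro member_le_sum) auto
  also have "\<dots> \<le> \<theta> ^ i * (1 / 8)" using y assms(2)[OF i] by simp
  finally show "\<bar>1 / real (x i) - 1 / real (y i)\<bar> * 8 \<le> 1"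
    using assms(1) by simp
qed

lemma close_symbols_miss_1_or_2:
  "1 \<notin> {b. \<bar>1 / real a - 1 / real b\<bar> \<le> 1 / 8} \<or> 2 \<notin> {b. \<bar>1 / real a - 1 / real b\<bar> \<le> 1 / 8}"
proof (cases "a \<le> 1")
  case True
  then have "a = 0 \<or> a = 1" by auto
  then show ?thesis by auto
next
  case False
  then have "1 / real a \<le> 1 / 2" by (intro divide_left_mono) auto
  then show ?thesis by auto
qed

text \<open>The tail of a centre is irrelevant for truncated distances; the constant 1 makes centres points
  of the full shift.\<close>

definition grid :: "nat \<Rightarrow> nat \<Rightarrow> (nat \<Rightarrow> nat) set" where
  "grid k N = (\<lambda>f i. if i < k then f i else 1) ` ({..<k} \<rightarrow>\<^sub>E {1..N})"

lemma finite_grid: "finite (grid k N)"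
  unfolding grid_def by (intro finite_imageI finite_PiE) auto

lemma card_grid_le: "card (grid k N) \<le> N ^ k"
  unfolding grid_def
  by (rule order_trans[OF card_image_le]) (auto intro: finite_PiE simp: card_PiE)

lemma grid_subset_full_shift: "grid k N \<subseteq> full_shift"
  by (fastforce simp: grid_def full_shift_def PiE_def Pi_def)

text \<open>Replacing a symbol larger than \<open>N\<close> by \<open>N\<close> changes its reciprocal by less than \<open>1 / N\<close>.\<close>

lemma grid_near:
  assumes \<theta>: "0 < \<theta>" "\<theta> < 1" and N: "1 \<le> N" and b: "b \<in> full_shift"
  obtains c where "c \<in> grid k N" "trunc_dist \<theta> k c b \<le> 1 / (real N * (1 - \<theta>))"
proof
  define c where "c = (\<lambda>i. if i < k then min (b i) N else 1)"
  show "c \<in> grid k N"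
    unfolding grid_def c_def using N b
    by (intro image_eqI[where x = "restrict (\<lambda>i. min (b i) N) {..<k}"])
       (auto simp: full_shift_def)
  have "\<bar>1 / real (min n N) - 1 / real n\<bar> \<le> 1 / real N" if "1 \<le> n" for n
  proof (cases "n \<le> N")
    case False
    then have "1 / real n \<le> 1 / real N" using N by (intro divide_left_mono) auto
    then show ?thesis using False by (simp add: min_def)
  qed (simp add: min_def)
  then have "trunc_dist \<theta> k c b \<le> (\<Sum>i<k. \<theta> ^ i * (1 / real N))"
    unfolding trunc_dist_def c_def using \<theta> b
    by (intro sum_mono mult_left_mono) (auto simp: full_shift_def)
  also have "\<dots> = (\<Sum>i<k. \<theta> ^ i) * (1 / real N)" by (simp only: sum_distrib_right)
  also have "\<dots> \<le> 1 / (1 - \<theta>) * (1 / real N)"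
    by (intro mult_right_mono sum_power_le \<theta>) auto
  finally show "trunc_dist \<theta> k c b \<le> 1 / (real N * (1 - \<theta>))" by (simp add: mult.commute)
qed

text \<open>The error consists of the radius of the visited set, the truncation of symbols at \<open>N\<close> and the
  truncation of sequences at depth \<open>k\<close>.\<close>

lemma covering_time_le:
  assumes \<theta>: "0 < \<theta>" "\<theta> < 1" and N: "1 \<le> N" and n: "1 \<le> n"
    and err: "r + 1 / (real N * (1 - \<theta>)) + \<theta> ^ k / (1 - \<theta>) \<le> \<delta>"
    and hit: "\<And>c. c \<in> grid k N \<Longrightarrow> \<exists>i\<le>n. (shift ^^ i) x \<in> trunc_ball \<theta> k r c"
  shows "covering_time \<theta> \<delta> x \<le> enat n"
proof -
  have "delta_dense \<theta> \<delta> {(shift ^^ i) x |i. i \<le> n}"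
    unfolding delta_dense_def
  proof
    fix b assume "b \<in> full_shift"
    then obtain c where c: "c \<in> grid k N" "trunc_dist \<theta> k c b \<le> 1 / (real N * (1 - \<theta>))"
      by (rule grid_near[OF \<theta> N])
    obtain i where i: "i \<le> n" "(shift ^^ i) x \<in> trunc_ball \<theta> k r c"
      using hit[OF c(1)] by blast
    let ?a = "(shift ^^ i) x"
    have "d1 \<theta> ?a b \<le> trunc_dist \<theta> k ?a b + \<theta> ^ k / (1 - \<theta>)"
      by (rule d1_le_trunc_dist[OF \<theta>])
    also have "trunc_dist \<theta> k ?a b \<le> trunc_dist \<theta> k ?a c + trunc_dist \<theta> k c b"
      by (rule trunc_dist_triangle[OF \<theta>(1)])
    also have "trunc_dist \<theta> k ?a c \<le> r"
      using i(2) by (simp add: trunc_ball_def trunc_dist_commute)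
    finally have "d1 \<theta> ?a b \<le> \<delta>" using c(2) err by simp
    then show "\<exists>a\<in>{(shift ^^ i) x |i. i \<le> n}. d1 \<theta> a b \<le> \<delta>" using i(1) by blast
  qed
  then show ?thesis
    unfolding covering_time_def using n by (intro INF_lower) simp
qed

context quasi_bernoulli begin

lemma expected_covering_time_le:
  assumes \<theta>: "0 < \<theta>" "\<theta> < 1" and N: "1 \<le> N"
    and box: "\<And>i. i < k \<Longrightarrow> r \<le> \<theta> ^ i / 8"
    and err: "r + 1 / (real N * (1 - \<theta>)) + \<theta> ^ k / (1 - \<theta>) \<le> \<delta>"
    and m: "0 < m" "\<And>c. c \<in> grid k N \<Longrightarrow> m \<le> prob (trunc_ball \<theta> k r c)"
  shows "expected_covering_time \<theta> \<mu> \<delta> \<le>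
    ennreal ((2 + 1 / (1 - decay_rate)) / m * (D / hit_prob * (real k * ln (real N)) + D / hit_prob + 1))"
proof -
  define L where "L = nat \<lceil>1 / m\<rceil>"
  let ?T = "L + k"
  let ?B = "trunc_ball \<theta> k r"
  let ?U = "\<lambda>c. \<Union>t<L. preimage_shift t (?B c)"
  let ?S = "\<lambda>c i. {b. \<bar>1 / real (c i) - 1 / real b\<bar> \<le> 1 / 8}"
  have L: "1 / m \<le> real L" unfolding L_def by (rule real_nat_ceiling_ge)
  have "real L \<le> 1 / m + 1"
    using m(1) unfolding L_def by (smt (verit) divide_nonneg_nonneg of_nat_nat ceiling_correct zero_le_ceiling)
  have "0 < 1 / m" using m by simp
  then have "0 < real L" using L by linarith
  then have L1: "1 \<le> L" by simp
  have "\<exists>c. c \<in> grid k N"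
    using grid_near[OF \<theta> N, of "\<lambda>_. 1" k] by (auto simp: full_shift_def)
  then obtain c0 where c0: "c0 \<in> grid k N" by blast
  have det: "determined_by ?T (?U c)" for c
    by (intro determined_by_UN determined_by_mono[OF determined_by_preimage_shift[OF determined_by_trunc_ball]]) auto
  have hit: "hit_prob \<le> prob (?U c)" if "c \<in> grid k N" for c
  proof (rule prob_hit_ge[OF determined_by_trunc_ball, where S = "?S c"])
    show "?B c \<subseteq> box k (?S c)" by (rule trunc_ball_subset_box[OF \<theta>(1) box])
    show "1 \<notin> ?S c i \<or> 2 \<notin> ?S c i" for i by (rule close_symbols_miss_1_or_2)
    have "1 \<le> real L * m" using L m(1) by (simp add: field_simps)
    also have "\<dots> \<le> real L * prob (?B c)" by (intro mult_left_mono m that) simp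
    finally show "1 \<le> real L * prob (?B c)" .
  qed
  \<comment> \<open>The summand 2 accounts for the window and its rounding, the other one for the overhang \<open>k\<close>.\<close>
  have T: "real ?T \<le> (2 + 1 / (1 - decay_rate)) / m"
  proof -
    have "m * real k \<le> prob (box k (?S c0)) * real k"
    proof (rule mult_right_mono)
      have "m \<le> prob (?B c0)" by (rule m(2)[OF c0])
      also have "\<dots> \<le> prob (box k (?S c0))"
        by (intro finite_measure_mono trunc_ball_subset_box[OF \<theta>(1) box] determined_in_sets[OF determined_by_box])
      finally show "m \<le> prob (box k (?S c0))" .
    qed simp
    also have "\<dots> = real k * prob (box k (?S c0))" by (rule mult.commute)
    also have "\<dots> \<le> 1 / (1 - decay_rate)"
      by (rule depth_times_prob_box_le) (rule close_symbols_miss_1_or_2)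
    finally have k: "m * real k \<le> 1 / (1 - decay_rate)" .
    have "m \<le> 1" using m(2)[OF c0] prob_le_1[of "?B c0"] by linarith
    moreover have "m * real L \<le> 1 + m"
      using \<open>real L \<le> 1 / m + 1\<close> m(1) by (simp add: field_simps)
    ultimately have "m * real ?T \<le> 2 + 1 / (1 - decay_rate)" using k by (simp add: distrib_left)
    then show ?thesis using m(1) by (simp add: pos_le_divide_eq mult.commute)
  qed
  have "expected_covering_time \<theta> \<mu> \<delta> \<le>
      ennreal (real ?T * (D / hit_prob * ln (real (card (grid k N))) + D / hit_prob + 1))"
    unfolding expected_covering_time_def
  proof (rule nn_integral_collection_time_le)
    show "finite (grid k N)" by (rule finite_grid)
    show "grid k N \<noteq> {}" using c0 by blast
    show "determined_by ?T (?U c)" for c by (rule det)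
    show "0 < hit_prob" by (rule hit_prob_pos)
    show "hit_prob \<le> prob (?U c)" if "c \<in> grid k N" for c by (rule hit[OF that])
    show "1 \<le> ?T" using L1 by simp
    fix x n assume x: "x \<in> full_shift" and *: "\<And>c. c \<in> grid k N \<Longrightarrow> x \<notin> avoid ?T (?U c) n"
    have ex: "\<exists>i<n * ?T. (shift ^^ i) x \<in> ?B c" if c: "c \<in> grid k N" for c
    proof -
      obtain j where j: "j < n" "(shift ^^ (j * ?T)) x \<in> ?U c"
        using *[OF c] x by (auto simp: avoid_def)
      then obtain t where t: "t < L" "(shift ^^ t) ((shift ^^ (j * ?T)) x) \<in> ?B c"
        by (auto simp: preimage_shift_def)
      have "t + j * ?T < Suc j * ?T" using t(1) by simp
      also have "\<dots> \<le> n * ?T" using j(1) by (intro mult_le_mono1) simp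
      finally show ?thesis using t(2) by (auto simp: funpow_add)
    qed
    have "covering_time \<theta> \<delta> x \<le> enat (n * ?T)"
    proof (rule covering_time_le[OF \<theta> N _ err])
      show "1 \<le> n * ?T" using ex[OF c0] by linarith
      show "\<exists>i\<le>n * ?T. (shift ^^ i) x \<in> ?B c" if "c \<in> grid k N" for c
        using ex[OF that] less_imp_le by blast
    qed
    then have "ennreal_of_enat (covering_time \<theta> \<delta> x) \<le> ennreal_of_enat (enat (n * ?T))"
      by (simp only: ennreal_of_enat_le_iff)
    then show "ennreal_of_enat (covering_time \<theta> \<delta> x) \<le> of_nat (n * ?T)"
      by (simp only: ennreal_of_enat_enat)
  qed
  also have "\<dots> \<le> ennreal ((2 + 1 / (1 - decay_rate)) / m * (D / hit_prob * (real k * ln (real N)) + D / hit_prob + 1))"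
  proof (intro ennreal_leI mult_mono T add_mono order_refl)
    have c1: "1 \<le> card (grid k N)"
      using c0 finite_grid[of k N] by (simp add: Suc_le_eq card_gt_0_iff) blast
    then have "ln (real (card (grid k N))) \<le> ln (real N ^ k)"
      using card_grid_le[of k N] N by (subst ln_le_cancel_iff) (auto simp: of_nat_power[symmetric] simp del: of_nat_power)
    then show "ln (real (card (grid k N))) \<le> real k * ln (real N)"
      using N by (simp add: ln_realpow)
    have D: "0 \<le> D / hit_prob" using D_pos hit_prob_pos by simp
    show "0 \<le> D / hit_prob" by (rule D)
    have "0 \<le> ln (real (card (grid k N)))" using c1 by simp
    then show "0 \<le> ln (real (card (grid k N)))"
      and "0 \<le> D / hit_prob * ln (real (card (grid k N))) + D / hit_prob + 1"
      using D by (auto intro!: add_nonneg_nonneg mult_nonneg_nonneg simp del: times_divide_eq_left)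
    show "0 \<le> (2 + 1 / (1 - decay_rate)) / m"
      using m(1) decay_rate_less_1 by simp
  qed
  finally show ?thesis .
qed

end

section \<open>The lower bound\<close>

text \<open>Around each of its points an open set contains a cylinder, and there are only countably many
  cylinders.\<close>

lemma openin_in_sets:
  assumes \<theta>: "0 < \<theta>" "\<theta> < 1"
    and U: "openin (Metric_space.mtopology full_shift (d1 \<theta>)) U"
  shows "U \<in> sets shift_space"
    and "x \<in> U \<Longrightarrow> \<exists>w. set w \<subseteq> {1..} \<and> cylinder w \<subseteq> U"
proof -
  interpret Metric_space full_shift "d1 \<theta>" by (rule Metric_space_d1[OF \<theta>])
  have cyl: "\<exists>k. cylinder (map x [0..<k]) \<subseteq> U \<and> x \<in> full_shift" if "x \<in> U" for x
  proof -
    obtain r where r: "0 < r" "mball x r \<subseteq> U" and x: "x \<in> full_shift"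
      using U \<open>x \<in> U\<close> unfolding openin_mtopology by blast
    have "(\<lambda>k. \<theta> ^ k / (1 - \<theta>)) \<longlonglongrightarrow> 0 / (1 - \<theta>)"
      using \<theta> by (intro tendsto_intros LIMSEQ_power_zero) auto
    then have "eventually (\<lambda>k. \<theta> ^ k / (1 - \<theta>) < r) sequentially"
      using r(1) by (intro order_tendstoD(2)) auto
    then obtain k where k: "\<theta> ^ k / (1 - \<theta>) < r"
      by (auto simp: eventually_sequentially)
    have "cylinder (map x [0..<k]) \<subseteq> mball x r"
    proof
      fix y assume y: "y \<in> cylinder (map x [0..<k])"
      then have "y \<in> trunc_ball \<theta> k 0 x" using cylinder_subset_trunc_ball[of 0 x k \<theta>] by blast
      then have "d1 \<theta> x y < r" 
        using d1_le_trunc_dist[OF \<theta>, of x y k] k by (simp add: trunc_ball_def)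
      then show "y \<in> mball x r" using x y by (simp add: cylinder_def)
    qed
    then show ?thesis using r(2) x by blast
  qed
  show "\<exists>w. set w \<subseteq> {1..} \<and> cylinder w \<subseteq> U" if x: "x \<in> U"
  proof -
    obtain k where k: "cylinder (map x [0..<k]) \<subseteq> U" "x \<in> full_shift" using cyl[OF x] by blast
    then have "set (map x [0..<k]) \<subseteq> {1..}" by (auto simp: full_shift_def)
    with k(1) show ?thesis by blast
  qed
  have "U = (\<Union>w\<in>{w. cylinder w \<subseteq> U}. cylinder w)"
  proof
    show "U \<subseteq> (\<Union>w\<in>{w. cylinder w \<subseteq> U}. cylinder w)"
    proof
      fix x assume "x \<in> U"
      then obtain k where k: "cylinder (map x [0..<k]) \<subseteq> U" "x \<in> full_shift" using cyl by blast
      then have "x \<in> cylinder (map x [0..<k])" by (simp add: cylinder_def)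
      with k(1) show "x \<in> (\<Union>w\<in>{w. cylinder w \<subseteq> U}. cylinder w)" by blast
    qed
  qed blast
  also have "\<dots> \<in> sets shift_space"
    by (rule sets.countable_UN'') (auto intro: sets_cylinder)
  finally show "U \<in> sets shift_space" .
qed

lemma covering_time_ge_1: "1 \<le> covering_time \<theta> \<delta> x"
  unfolding covering_time_def by (intro INF_greatest) (auto simp: one_enat_def)

lemma covering_time_antimono:
  assumes "\<delta> \<le> \<delta>'"
  shows "covering_time \<theta> \<delta>' x \<le> covering_time \<theta> \<delta> x"
proof -
  have "delta_dense \<theta> \<delta>' A" if "delta_dense \<theta> \<delta> A" for A
    using that assms unfolding delta_dense_def by (meson order_trans)
  then show ?thesis
    unfolding covering_time_def by (intro INF_superset_mono order_refl) blast
qed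

lemma covering_time_le_imp_visit:
  assumes "covering_time \<theta> \<delta> x \<le> enat n" and "b \<in> full_shift"
  shows "\<exists>i\<le>n. d1 \<theta> ((shift ^^ i) x) b \<le> \<delta>"
proof -
  let ?A = "{n. 1 \<le> n \<and> delta_dense \<theta> \<delta> {(shift ^^ i) x |i. i \<le> n}}"
  have "?A \<noteq> {}"
  proof
    assume "?A = {}"
    then have "covering_time \<theta> \<delta> x = top"
      by (simp only: covering_time_def image_empty Inf_empty)
    then show False using assms(1) by (simp add: top_enat_def)
  qed
  then obtain m' where "m' \<in> ?A" by blast
  then have "Inf (enat ` ?A) \<in> enat ` ?A" by (intro wellorder_InfI[of "enat m'"] imageI)
  then obtain m where "m \<in> ?A" "covering_time \<theta> \<delta> x = enat m"
    unfolding covering_time_def by auto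
  then have "m \<le> n" using assms(1) by simp
  moreover obtain i where "i \<le> m" "d1 \<theta> ((shift ^^ i) x) b \<le> \<delta>"
    using \<open>m \<in> ?A\<close> assms(2) unfolding delta_dense_def by blast
  ultimately show ?thesis by (meson order_trans)
qed

context quasi_bernoulli begin

lemma supp_eq_full_shift:
  assumes \<theta>: "0 < \<theta>" "\<theta> < 1"
  shows "supp \<theta> \<mu> = full_shift"
proof -
  have "0 < emeasure \<mu> U"
    if U: "openin (Metric_space.mtopology full_shift (d1 \<theta>)) U" "x \<in> U" for U x
  proof -
    obtain w where w: "set w \<subseteq> {1..}" "cylinder w \<subseteq> U"
      using openin_in_sets(2)[OF \<theta> U] by blast
    have "0 < emeasure \<mu> (cylinder w)"
      using prob_cylinder_pos[OF w(1)] by (simp add: emeasure_eq_measure)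
    also have "\<dots> \<le> emeasure \<mu> U"
      using w(2) openin_in_sets(1)[OF \<theta> U(1)] sets_eq by (intro emeasure_mono) auto
    finally show ?thesis .
  qed
  then show ?thesis by (auto simp: supp_def)
qed

lemma expected_covering_time_ge_1: "1 \<le> expected_covering_time \<theta> \<mu> \<delta>"
proof -
  have "(\<integral>\<^sup>+x. 1 \<partial>\<mu>) \<le> expected_covering_time \<theta> \<mu> \<delta>"
    unfolding expected_covering_time_def
    by (intro nn_integral_mono) (metis covering_time_ge_1 ennreal_of_enat_1 ennreal_of_enat_le_iff)
  then show ?thesis by (simp add: emeasure_space_1)
qed

text \<open>If the ball has measure \<open>g \<le> 1/2\<close>, then with probability at least \<open>1/2\<close> it is not visited during
  the first \<open>\<lfloor>1/(2g)\<rfloor> \<ge> 1/(4g)\<close> steps. For larger \<open>g\<close> the covering time is at least 1 anyway.\<close>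

lemma expected_covering_time_ge_ball:
  assumes \<theta>: "0 < \<theta>" "\<theta> < 1" and b: "b \<in> full_shift" and R: "0 < \<delta>" "\<delta> < R"
  shows "ennreal (1 / 8) \<le> expected_covering_time \<theta> \<mu> \<delta> *
    emeasure \<mu> (Metric_space.mball full_shift (d1 \<theta>) b R)"
proof -
  interpret Metric_space full_shift "d1 \<theta>" by (rule Metric_space_d1[OF \<theta>])
  let ?G = "mball b R"
  let ?E = "expected_covering_time \<theta> \<mu> \<delta>"
  have G: "?G \<in> sets \<mu>" using openin_in_sets(1)[OF \<theta> openin_mball] sets_eq by simp
  define g where "g = prob ?G"
  have "b \<in> supp \<theta> \<mu>" using b supp_eq_full_shift[OF \<theta>] by simp
  moreover have "b \<in> ?G" using b R by simp
  ultimately have "0 < emeasure \<mu> ?G" unfolding supp_def using openin_mball by blast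
  then have g0: "0 < g" by (simp add: g_def emeasure_eq_measure)
  show ?thesis
  proof (cases "g \<le> 1 / 2")
    case False
    have "ennreal (1 / 8) \<le> 1 * ennreal g"
      using False by (simp add: ennreal_leI)
    also have "\<dots> \<le> ?E * ennreal g"
      by (intro mult_right_mono expected_covering_time_ge_1) simp
    finally show ?thesis by (simp add: emeasure_eq_measure g_def)
  next
    case True
    define n where "n = nat \<lfloor>1 / (2 * g)\<rfloor>"
    have one: "1 \<le> 1 / (2 * g)" using True g0 by (simp add: field_simps)
    then have "0 \<le> \<lfloor>1 / (2 * g)\<rfloor>" by linarith
    then have fl: "real n = of_int \<lfloor>1 / (2 * g)\<rfloor>" unfolding n_def by (rule of_nat_nat)
    then have n_le: "real n \<le> 1 / (2 * g)" by linarith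
    have n_ge: "1 / (4 * g) \<le> real n"
    proof -
      have "1 \<le> \<lfloor>1 / (2 * g)\<rfloor>" using one by (simp add: le_floor_iff)
      then have "1 / (2 * g) \<le> 2 * real n" using fl by linarith
      then show ?thesis by simp
    qed
    let ?V = "full_shift - (\<Union>i<n. preimage_shift i ?G)"
    have H: "preimage_shift i ?G \<in> sets \<mu>" "prob (preimage_shift i ?G) = g" for i
      using preimage_shift_invariant[OF G] by (auto simp: g_def)
    have V: "?V \<in> sets \<mu>"
      using H(1) determined_in_sets[OF determined_by_full_shift] by blast
    have "prob (\<Union>i<n. preimage_shift i ?G) \<le> (\<Sum>i<n. prob (preimage_shift i ?G))"
      using H(1) by (intro finite_measure_subadditive_finite) auto
    also have "\<dots> = real n * g" by (simp add: H(2))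
    also have "\<dots> \<le> 1 / 2" using n_le g0 by (simp add: field_simps)
    finally have pV: "1 / 2 \<le> prob ?V"
      using H(1) by (subst prob_compl_full_shift) auto
    have "ennreal (1 / 8) \<le> ennreal (real n * (1 / 2) * g)"
      using n_ge g0 by (intro ennreal_leI) (simp add: field_simps)
    also have "\<dots> \<le> ennreal (real n * prob ?V * g)"
      using pV g0 by (intro ennreal_leI mult_right_mono mult_left_mono) auto
    also have "\<dots> = (of_nat n * emeasure \<mu> ?V) * ennreal g"
      using g0 by (simp add: emeasure_eq_measure ennreal_mult ennreal_of_nat_eq_real_of_nat)
    also have "of_nat n * emeasure \<mu> ?V = (\<integral>\<^sup>+x. of_nat n * indicator ?V x \<partial>\<mu>)"
      using V by (simp add: nn_integral_cmult_indicator)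
    also have "\<dots> \<le> ?E"
      unfolding expected_covering_time_def
    proof (intro nn_integral_mono)
      fix x
      have "enat n \<le> covering_time \<theta> \<delta> x" if x: "x \<in> ?V"
      proof (rule ccontr)
        assume "\<not> enat n \<le> covering_time \<theta> \<delta> x"
        then obtain m where m: "covering_time \<theta> \<delta> x = enat m" "m < n"
          by (metis enat_iless enat_ord_simps(2) not_le_imp_less)
        then obtain i where i: "i \<le> m" "d1 \<theta> ((shift ^^ i) x) b \<le> \<delta>"
          using covering_time_le_imp_visit[of \<theta> \<delta> x m b] b by auto
        then have "d1 \<theta> b ((shift ^^ i) x) < R" using R commute[of b] by simp
        then have "(shift ^^ i) x \<in> ?G"
          using x b funpow_shift_in_full_shift by simp
        then show False using x i(1) m(2) by (auto simp: preimage_shift_def)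
      qed
      then show "of_nat n * indicator ?V x \<le> ennreal_of_enat (covering_time \<theta> \<delta> x)"
        by (cases "x \<in> ?V") (auto simp: of_nat_eq_enat)
    qed
    finally show ?thesis by (simp add: emeasure_eq_measure g_def mult_right_mono)
  qed
qed

lemma min_ball_measure_le:
  assumes "0 < \<theta>" "\<theta> < 1" and "x \<in> full_shift"
  shows "min_ball_measure \<theta> \<mu> r \<le> emeasure \<mu> (Metric_space.mball full_shift (d1 \<theta>) x r)"
  unfolding min_ball_measure_def supp_eq_full_shift[OF assms(1,2)] by (rule INF_lower[OF assms(3)])

text \<open>This is \<open>expected_covering_time_ge_ball\<close>, rearranged, for the infimum over all centres. If the
  expectation is finite, the same bound shows that the infimum is positive.\<close>

lemma expected_covering_time_ge:
  assumes \<theta>: "0 < \<theta>" "\<theta> < 1" and R: "0 < \<delta>" "\<delta> < R"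
  shows "ennreal (1 / 8) / min_ball_measure \<theta> \<mu> R \<le> expected_covering_time \<theta> \<mu> \<delta>"
proof (cases "expected_covering_time \<theta> \<mu> \<delta> = top")
  case False
  let ?E = "expected_covering_time \<theta> \<mu> \<delta>" and ?M = "min_ball_measure \<theta> \<mu> R"
  have E0: "0 < ?E" using expected_covering_time_ge_1[of \<theta> \<delta>] by (meson less_le_trans zero_less_one)
  have low: "ennreal (1 / 8) / ?E \<le> ?M"
    unfolding min_ball_measure_def supp_eq_full_shift[OF \<theta>]
    by (intro INF_greatest divide_le_posI_ennreal E0 expected_covering_time_ge_ball[OF \<theta> _ R])
  have "0 < ennreal (1 / 8) / ?E" using False by (simp add: ennreal_zero_less_divide less_top)
  then have M0: "0 < ?M" using low by (rule less_le_trans)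
  have "ennreal (1 / 8) = ennreal (1 / 8) * ?E / ?E"
    using E0 False by (intro mult_divide_eq_ennreal[symmetric]) auto
  also have "\<dots> = ?E * (ennreal (1 / 8) / ?E)"
    by (simp only: ennreal_times_divide mult.commute)
  also have "\<dots> \<le> ?E * ?M" using low by (intro mult_left_mono) auto
  finally show ?thesis by (intro divide_le_posI_ennreal M0) (simp add: mult.commute)
qed simp

end

section \<open>The upper bound\<close>

text \<open>\<open>N\<close> is the least natural number with \<open>N \<ge> Y\<close>, and \<open>k\<close> the least one with \<open>\<theta> ^ k \<le> 1 / Y\<close>. The choice of \<open>Y\<close> bounds
  each of the two truncation errors by \<open>\<delta> / 4\<close>. The minimality of \<open>k\<close> means that \<open>\<theta> ^ i > 1 / Y\<close>
  for \<open>i < k\<close>, and the factor \<open>\<epsilon>\<close> is chosen to turn this into the second claim.\<close>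

lemma exists_depth_and_resolution:
  fixes \<theta> \<delta> :: real
  assumes \<theta>: "0 < \<theta>" "\<theta> < 1" and \<delta>: "0 < \<delta>" "\<delta> \<le> 1"
  defines "Y \<equiv> 4 / ((1 - \<theta>) * \<delta>)" and "\<epsilon> \<equiv> (1 - \<theta>) / 32"
  obtains k N :: nat where "1 \<le> N" "\<And>i. i < k \<Longrightarrow> \<epsilon> * \<delta> \<le> \<theta> ^ i / 8"
    "\<epsilon> * \<delta> + 1 / (real N * (1 - \<theta>)) + \<theta> ^ k / (1 - \<theta>) \<le> \<delta>"
    "real k * ln (real N) \<le> 2 * (1 / ln (1 / \<theta>) + 1) * (ln Y)\<^sup>2"
proof
  define \<Lambda> where "\<Lambda> = ln (1 / \<theta>)"
  have \<Lambda>: "0 < \<Lambda>" using \<theta> by (simp add: \<Lambda>_def)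
  define k where "k = nat \<lceil>ln Y / \<Lambda>\<rceil>"
  define N where "N = nat \<lceil>Y\<rceil>"
  have den: "0 < (1 - \<theta>) * \<delta>" "(1 - \<theta>) * \<delta> \<le> 1" using \<theta> \<delta> by (auto intro: mult_le_one)
  then have Y4: "4 \<le> Y" unfolding Y_def by (simp add: field_simps)
  have lnY: "1 \<le> ln Y"
  proof -
    have "exp 1 \<le> Y" using exp_le Y4 by linarith
    then show ?thesis using Y4 by (simp add: ln_ge_iff)
  qed
  have pow: "\<theta> ^ i = exp (- (\<Lambda> * real i))" for i
    using \<theta> by (simp add: \<Lambda>_def ln_div exp_of_nat2_mult)
  have YN: "Y \<le> real N" unfolding N_def by (rule real_nat_ceiling_ge)
  have NY: "real N \<le> 2 * Y" using Y4 unfolding N_def by linarith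
  have kY: "ln Y / \<Lambda> \<le> real k" unfolding k_def by (rule real_nat_ceiling_ge)
  have Yk: "real k \<le> ln Y / \<Lambda> + 1"
    using \<Lambda> lnY divide_nonneg_pos[of "ln Y" \<Lambda>] unfolding k_def by linarith
  show "1 \<le> N" using YN Y4 by linarith
  show "\<epsilon> * \<delta> \<le> \<theta> ^ i / 8" if i: "i < k" for i
  proof -
    have "real i \<le> ln Y / \<Lambda>" using Yk i by linarith
    then have "\<Lambda> * real i \<le> ln Y" using \<Lambda> by (simp add: field_simps)
    then have "exp (- ln Y) \<le> \<theta> ^ i" by (simp add: pow)
    then have "1 / Y \<le> \<theta> ^ i" using Y4 by (simp add: exp_minus inverse_eq_divide)
    then show ?thesis unfolding Y_def \<epsilon>_def by (simp add: mult.commute)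
  qed
  show "\<epsilon> * \<delta> + 1 / (real N * (1 - \<theta>)) + \<theta> ^ k / (1 - \<theta>) \<le> \<delta>"
  proof -
    have "ln Y \<le> \<Lambda> * real k" using kY \<Lambda> by (simp add: field_simps)
    then have "\<theta> ^ k \<le> exp (- ln Y)" by (simp add: pow)
    then have "\<theta> ^ k \<le> 1 / Y" using Y4 by (simp add: exp_minus inverse_eq_divide)
    then have "\<theta> ^ k \<le> (1 - \<theta>) * \<delta> / 4" by (simp add: Y_def)
    then have "\<theta> ^ k / (1 - \<theta>) \<le> \<delta> / 4" using \<theta> by (simp add: field_simps)
    moreover have "1 / (real N * (1 - \<theta>)) \<le> 1 / (Y * (1 - \<theta>))"
      using YN Y4 \<theta> by (intro divide_left_mono mult_right_mono mult_pos_pos) auto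
    moreover have "1 / (Y * (1 - \<theta>)) = \<delta> / 4" using \<theta> by (simp add: Y_def field_simps)
    moreover have "\<epsilon> * \<delta> \<le> 1 / 2 * \<delta>" using \<theta> \<delta> unfolding \<epsilon>_def by (intro mult_right_mono) auto
    ultimately show ?thesis by linarith
  qed
  have "ln (real N) \<le> ln (2 * Y)" using NY YN Y4 by (subst ln_le_cancel_iff) auto
  also have "\<dots> \<le> 2 * ln Y" using Y4 ln_le_cancel_iff[of 2 Y] by (simp add: ln_mult)
  finally have lnN: "ln (real N) \<le> 2 * ln Y" .
  have "real k \<le> (1 / \<Lambda> + 1) * ln Y" using Yk lnY by (simp add: distrib_right)
  then have "real k * ln (real N) \<le> ((1 / \<Lambda> + 1) * ln Y) * (2 * ln Y)"
    using lnN lnY \<Lambda> YN Y4 by (intro mult_mono) auto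
  then show "real k * ln (real N) \<le> 2 * (1 / ln (1 / \<theta>) + 1) * (ln Y)\<^sup>2"
    unfolding \<Lambda>_def[symmetric] by (simp add: power2_eq_square mult_ac)
qed

context quasi_bernoulli begin

text \<open>Distance \<open>\<eta>\<close> from 1 gives \<open>ln (1 / \<delta>) \<ge> \<eta>\<close>, so additive constants are absorbed into multiples of
  \<open>ln (1 / \<delta>)\<close>.\<close>

lemma expected_covering_time_le_small:
  assumes \<theta>: "0 < \<theta>" "\<theta> < 1" and \<eta>: "0 < \<eta>"
  obtains C where "0 < C" "\<And>\<delta>. 0 < \<delta> \<Longrightarrow> \<delta> \<le> 1 - \<eta> \<Longrightarrow>
    expected_covering_time \<theta> \<mu> \<delta>
      \<le> ennreal C / min_ball_measure \<theta> \<mu> ((1 - \<theta>) / 32 * \<delta>) * ennreal ((ln (1 / \<delta>))\<^sup>2)"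
proof
  define A where "A = 2 + 1 / (1 - decay_rate)"
  define B where "B = D / hit_prob"
  define E where "E = 2 * (1 / ln (1 / \<theta>) + 1)"
  define W where "W = ln (4 / (1 - \<theta>)) / \<eta> + 1"
  define C where "C = A * (B * (E * W\<^sup>2) + (B + 1) / \<eta>\<^sup>2)"
  have A0: "0 < A" using decay_rate_less_1 by (simp add: A_def add_pos_pos)
  have B0: "0 < B" using D_pos hit_prob_pos by (simp add: B_def)
  have E0: "0 < E" using \<theta> by (simp add: E_def add_pos_pos)
  have q: "0 \<le> ln (4 / (1 - \<theta>))" using \<theta> by (intro ln_ge_zero) (simp add: field_simps)
  show C0: "0 < C" using A0 B0 E0 \<eta> unfolding C_def
    by (intro mult_pos_pos add_nonneg_pos) auto
  fix \<delta> :: real assume \<delta>: "0 < \<delta>" "\<delta> \<le> 1 - \<eta>"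
  define l where "l = ln (1 / \<delta>)"
  have l: "\<eta> \<le> l" using ln_le_minus_one[of \<delta>] \<delta> by (simp add: l_def ln_div)
  define Y where "Y = 4 / ((1 - \<theta>) * \<delta>)"
  let ?\<epsilon> = "(1 - \<theta>) / 32"
  have "\<delta> \<le> 1" using \<delta> \<eta> by simp
  then obtain k N where kN: "1 \<le> N" "\<And>i. i < k \<Longrightarrow> ?\<epsilon> * \<delta> \<le> \<theta> ^ i / 8"
    "?\<epsilon> * \<delta> + 1 / (real N * (1 - \<theta>)) + \<theta> ^ k / (1 - \<theta>) \<le> \<delta>"
    "real k * ln (real N) \<le> 2 * (1 / ln (1 / \<theta>) + 1) * (ln (4 / ((1 - \<theta>) * \<delta>)))\<^sup>2"
    by (rule exists_depth_and_resolution[OF \<theta> \<delta>(1)]) (rule that; assumption)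
  then have kN4: "real k * ln (real N) \<le> E * (ln Y)\<^sup>2" by (simp only: E_def Y_def)
  have lnY: "0 \<le> ln Y" "ln Y \<le> W * l"
  proof -
    have "ln Y = ln (4 / (1 - \<theta>) * (1 / \<delta>))" by (simp add: Y_def)
    also have "\<dots> = ln (4 / (1 - \<theta>)) + l" using \<theta> \<delta> unfolding l_def by (intro ln_mult_pos) auto
    finally have Y: "ln Y = ln (4 / (1 - \<theta>)) + l" .
    show "0 \<le> ln Y" using Y q l \<eta> by simp
    have "ln (4 / (1 - \<theta>)) * \<eta> \<le> ln (4 / (1 - \<theta>)) * l" by (intro mult_left_mono q l)
    then have "ln (4 / (1 - \<theta>)) \<le> ln (4 / (1 - \<theta>)) / \<eta> * l" using \<eta> by (simp add: field_simps)
    then show "ln Y \<le> W * l" by (simp add: Y W_def distrib_right)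
  qed
  let ?M = "min_ball_measure \<theta> \<mu> (?\<epsilon> * \<delta>)"
  show "expected_covering_time \<theta> \<mu> \<delta> \<le> ennreal C / ?M * ennreal (l\<^sup>2)"
  proof (cases "?M = 0")
    case True
    \<comment> \<open>The right-hand side is infinite, as the logarithm does not vanish.\<close>
    then show ?thesis using C0 l \<eta> by (simp add: ennreal_top_mult)
  next
    case False
    have M_le: "?M \<le> ennreal (prob (trunc_ball \<theta> k (?\<epsilon> * \<delta>) c))" if "c \<in> full_shift" for c
    proof -
      have "?M \<le> emeasure \<mu> (Metric_space.mball full_shift (d1 \<theta>) c (?\<epsilon> * \<delta>))"
        by (rule min_ball_measure_le[OF \<theta> that])
      also have "\<dots> \<le> emeasure \<mu> (trunc_ball \<theta> k (?\<epsilon> * \<delta>) c)"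
        by (intro emeasure_mono mball_subset_trunc_ball[OF \<theta>] determined_in_sets[OF determined_by_trunc_ball])
      finally show ?thesis by (simp add: emeasure_eq_measure)
    qed
    have one_in: "(\<lambda>_. 1) \<in> full_shift" by (simp add: full_shift_def)
    then have "?M < top" using M_le by (meson ennreal_less_top le_less_trans)
    then obtain m where m: "?M = ennreal m" "0 < m"
      using False by (cases ?M) (auto simp: less_le)
    have "expected_covering_time \<theta> \<mu> \<delta> \<le> ennreal (A / m * (B * (real k * ln (real N)) + B + 1))"
      unfolding A_def B_def
    proof (rule expected_covering_time_le[OF \<theta> kN(1-3) m(2)])
      fix c assume "c \<in> grid k N"
      then have "ennreal m \<le> ennreal (prob (trunc_ball \<theta> k (?\<epsilon> * \<delta>) c))"
        using M_le grid_subset_full_shift unfolding m(1) by blast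
      then show "m \<le> prob (trunc_ball \<theta> k (?\<epsilon> * \<delta>) c)" by simp
    qed
    also have "\<dots> \<le> ennreal (C / m * l\<^sup>2)"
    proof (rule ennreal_leI)
      have "real k * ln (real N) \<le> E * (W\<^sup>2 * l\<^sup>2)"
      proof -
        have "(ln Y)\<^sup>2 \<le> (W * l)\<^sup>2" using lnY by (intro power_mono) auto
        then have "E * (ln Y)\<^sup>2 \<le> E * (W\<^sup>2 * l\<^sup>2)" using E0 by (simp add: power_mult_distrib)
        then show ?thesis using kN4 by linarith
      qed
      then have "B * (real k * ln (real N)) \<le> B * (E * (W\<^sup>2 * l\<^sup>2))"
        using B0 by (intro mult_left_mono) auto
      moreover have "B + 1 \<le> (B + 1) / \<eta>\<^sup>2 * l\<^sup>2"
      proof -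
        have "\<eta>\<^sup>2 \<le> l\<^sup>2" using l \<eta> by (intro power_mono) auto
        then have "1 \<le> l\<^sup>2 / \<eta>\<^sup>2" using \<eta> by simp
        then have "(B + 1) * 1 \<le> (B + 1) * (l\<^sup>2 / \<eta>\<^sup>2)" using B0 by (intro mult_left_mono) auto
        then show ?thesis by simp
      qed
      ultimately have "B * (real k * ln (real N)) + B + 1
          \<le> (B * (E * W\<^sup>2) + (B + 1) / \<eta>\<^sup>2) * l\<^sup>2"
        by (simp add: distrib_right mult.assoc)
      then have "A / m * (B * (real k * ln (real N)) + B + 1)
          \<le> A / m * ((B * (E * W\<^sup>2) + (B + 1) / \<eta>\<^sup>2) * l\<^sup>2)"
        using A0 m(2) by (intro mult_left_mono) auto
      then show "A / m * (B * (real k * ln (real N)) + B + 1) \<le> C / m * l\<^sup>2"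
        by (simp add: C_def)
    qed
    also have "\<dots> = ennreal (C / m) * ennreal (l\<^sup>2)"
      using C0 m(2) by (intro ennreal_mult) auto
    also have "ennreal (C / m) = ennreal C / ?M"
      using C0 m(2) unfolding m(1) by (intro divide_ennreal[symmetric]) auto
    finally show ?thesis .
  qed
qed

text \<open>There are finitely many centres, and each truncated ball contains a cylinder, so their measures
  have a positive minimum.\<close>

lemma expected_covering_time_half_finite:
  assumes \<theta>: "0 < \<theta>" "\<theta> < 1"
  shows "expected_covering_time \<theta> \<mu> (1 / 2) < top"
proof -
  let ?r = "(1 - \<theta>) / 32 * (1 / 2)"
  obtain k N where kN: "1 \<le> N" "\<And>i. i < k \<Longrightarrow> ?r \<le> \<theta> ^ i / 8"
    "?r + 1 / (real N * (1 - \<theta>)) + \<theta> ^ k / (1 - \<theta>) \<le> 1 / 2"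
    by (rule exists_depth_and_resolution[OF \<theta>, of "1 / 2"], simp, simp) (rule that; assumption)
  let ?P = "(\<lambda>c. prob (trunc_ball \<theta> k ?r c)) ` grid k N"
  have fin: "finite ?P" using finite_grid by blast
  obtain c0 where "c0 \<in> grid k N"
    using grid_near[OF \<theta> kN(1), of "\<lambda>_. 1" k] by (auto simp: full_shift_def)
  then have ne: "?P \<noteq> {}" by blast
  have pos: "0 < prob (trunc_ball \<theta> k ?r c)" if "c \<in> grid k N" for c
  proof -
    have "set (map c [0..<k]) \<subseteq> {1..}"
      using that grid_subset_full_shift by (fastforce simp: full_shift_def)
    then have "0 < prob (cylinder (map c [0..<k]))" by (rule prob_cylinder_pos)
    also have "\<dots> \<le> prob (trunc_ball \<theta> k ?r c)"
      using \<theta> by (intro finite_measure_mono cylinder_subset_trunc_ball determined_in_sets[OF determined_by_trunc_ball]) simp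
    finally show ?thesis .
  qed
  have "0 < Min ?P" using pos by (subst Min_gr_iff[OF fin ne]) blast
  moreover have "Min ?P \<le> prob (trunc_ball \<theta> k ?r c)" if "c \<in> grid k N" for c
    using fin that by (intro Min_le) auto
  ultimately show ?thesis
    using expected_covering_time_le[OF \<theta> kN] ennreal_less_top le_less_trans by blast
qed

text \<open>For \<open>\<delta> > 1\<close> the covering time is at most that for \<open>\<delta> = 1/2\<close>, while \<open>1 / M\<^sub>\<mu> \<ge> 1\<close> and the logarithm stays
  away from 0.\<close>

lemma expected_covering_time_le_large:
  assumes \<theta>: "0 < \<theta>" "\<theta> < 1" and \<eta>: "0 < \<eta>"
  obtains C where "0 < C" "\<And>\<delta> r. 1 + \<eta> \<le> \<delta> \<Longrightarrow>
    expected_covering_time \<theta> \<mu> \<delta>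
      \<le> ennreal C / min_ball_measure \<theta> \<mu> r * ennreal ((ln (1 / \<delta>))\<^sup>2)"
proof -
  obtain e where e: "expected_covering_time \<theta> \<mu> (1 / 2) = ennreal e" "0 \<le> e"
    using expected_covering_time_half_finite[OF \<theta>] by (cases "expected_covering_time \<theta> \<mu> (1 / 2)") auto
  define s where "s = (ln (1 + \<eta>))\<^sup>2"
  have s: "0 < s" using \<eta> by (simp add: s_def)
  define C where "C = (e + 1) / s"
  have C: "0 < C" using e s by (simp add: C_def)
  have "expected_covering_time \<theta> \<mu> \<delta>
      \<le> ennreal C / min_ball_measure \<theta> \<mu> r * ennreal ((ln (1 / \<delta>))\<^sup>2)" if \<delta>: "1 + \<eta> \<le> \<delta>" for \<delta> r
  proof -
    let ?M = "min_ball_measure \<theta> \<mu> r"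
    have "?M \<le> emeasure \<mu> (Metric_space.mball full_shift (d1 \<theta>) (\<lambda>_. 1) r)"
      by (rule min_ball_measure_le[OF \<theta>]) (simp add: full_shift_def)
    then have M: "?M \<le> 1" using emeasure_le_1 order_trans by blast
    have "ln (1 + \<eta>) \<le> ln \<delta>" using \<delta> \<eta> by simp
    then have "s \<le> (ln \<delta>)\<^sup>2" using \<eta> unfolding s_def by (intro power_mono) auto
    then have s2: "s \<le> (ln (1 / \<delta>))\<^sup>2" using \<delta> \<eta> by (simp add: ln_div)
    have "expected_covering_time \<theta> \<mu> \<delta> \<le> expected_covering_time \<theta> \<mu> (1 / 2)"
      unfolding expected_covering_time_def using \<delta> \<eta>
      by (intro nn_integral_mono) (simp add: covering_time_antimono)
    also have "\<dots> \<le> ennreal (C * s)" using s e by (simp add: C_def ennreal_leI)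
    also have "\<dots> = ennreal C * ennreal s" using C s by (intro ennreal_mult) auto
    also have "ennreal C * ennreal s \<le> ennreal C / ?M * ennreal s"
    proof -
      have "ennreal C \<le> ennreal C / ?M"
      proof (cases "?M = 0")
        case False
        then obtain m where m: "?M = ennreal m" "0 < m" "m \<le> 1"
          using M by (cases ?M) (auto simp: less_le top_unique)
        have "C \<le> C / m" using C m by (simp add: field_simps)
        then show ?thesis using C m by (simp add: divide_ennreal ennreal_leI)
      qed (use C in simp)
      then show ?thesis by (rule mult_right_mono) simp
    qed
    also have "ennreal C / ?M * ennreal s \<le> ennreal C / ?M * ennreal ((ln (1 / \<delta>))\<^sup>2)"
      by (intro mult_left_mono ennreal_leI s2) auto
    finally show ?thesis .
  qed
  with C show thesis by (rule that)
qed

end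

section \<open>Gibbs measures are quasi-Bernoulli\<close>

lemma birkhoff_sum_add:
  "birkhoff_sum \<phi> (m + n) x = birkhoff_sum \<phi> m x + birkhoff_sum \<phi> n ((shift ^^ m) x)"
proof -
  have "(shift ^^ i) ((shift ^^ m) x) = (shift ^^ (m + i)) x" for i
    by (simp add: funpow_shift add_ac)
  then show ?thesis
    by (induction n) (simp_all add: birkhoff_sum_def)
qed

text \<open>Birkhoff sums are additive along concatenated words, so three applications of the Gibbs
  inequality, to \<open>u\<close>, to \<open>v\<close> and to \<open>uv\<close>, give the product bounds with \<open>D = K\<^sup>3\<close>.\<close>

lemma gibbs_measure_quasi_bernoulli:
  assumes "gibbs_measure \<phi> \<mu>"
  obtains D where "quasi_bernoulli \<mu> D"
proof -
  from assms obtain K P where inv: "invariant_prob \<mu>" and K: "K > 1" and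
    gibbs: "\<And>w x. w \<noteq> [] \<Longrightarrow> set w \<subseteq> {1..} \<Longrightarrow> x \<in> cylinder w \<Longrightarrow>
       1 / K \<le> measure \<mu> (cylinder w) / exp (birkhoff_sum \<phi> (length w) x - real (length w) * P) \<and>
       measure \<mu> (cylinder w) / exp (birkhoff_sum \<phi> (length w) x - real (length w) * P) \<le> K"
    unfolding gibbs_measure_def by blast
  interpret prob_space \<mu> using inv by (simp add: invariant_prob_def)
  have sets: "sets \<mu> = sets shift_space" using inv by (simp add: invariant_prob_def)
  define G where "G w x = exp (birkhoff_sum \<phi> (length w) x - real (length w) * P)" for w :: "nat list" and x
  have G0: "0 < G w x" for w x by (simp add: G_def)
  have low: "G w x \<le> K * prob (cylinder w)" and up: "prob (cylinder w) \<le> K * G w x"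
    if w: "set w \<subseteq> {1..}" "x \<in> cylinder w" for w x
  proof -
    have "G w x \<le> K * prob (cylinder w) \<and> prob (cylinder w) \<le> K * G w x"
    proof (cases "w = []")
      case True
      then show ?thesis
        using K prob_space sets_eq_imp_space_eq[OF sets]
        by (simp add: G_def birkhoff_sum_def cylinder_def space_shift_space)
    next
      case False
      then show ?thesis using gibbs[OF False w] K G0[of w x]
        unfolding G_def[symmetric] by (simp add: field_simps)
    qed
    then show "G w x \<le> K * prob (cylinder w)" "prob (cylinder w) \<le> K * G w x" by auto
  qed
  have inhabited: "\<exists>x. x \<in> cylinder w" if "set w \<subseteq> {1..}" for w
    using that by (intro exI[of _ "\<lambda>i. if i < length w then w ! i else 1"])
      (auto simp: cylinder_def full_shift_def dest: nth_mem)
  have pos: "0 < prob (cylinder w)" if w: "set w \<subseteq> {1..}" for w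
  proof -
    obtain x where "x \<in> cylinder w" using inhabited[OF w] by blast
    then have "0 < K * prob (cylinder w)" using low[OF w] G0[of w x] by (meson less_le_trans)
    then show ?thesis using K by (simp add: zero_less_mult_iff)
  qed
  have append: "prob (cylinder (u @ v)) \<le> K ^ 3 * prob (cylinder u) * prob (cylinder v) \<and>
      prob (cylinder u) * prob (cylinder v) \<le> K ^ 3 * prob (cylinder (u @ v))"
    if uv: "set u \<subseteq> {1..}" "set v \<subseteq> {1..}" for u v
  proof -
    have w: "set (u @ v) \<subseteq> {1..}" using uv by simp
    obtain x where x: "x \<in> cylinder (u @ v)" using inhabited[OF w] by blast
    let ?y = "(shift ^^ length u) x"
    have xu: "x \<in> cylinder u" and yv: "?y \<in> cylinder v"
      using x by (auto simp: cylinder_append preimage_shift_def)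
    have G: "G (u @ v) x = G u x * G v ?y"
      by (simp add: G_def birkhoff_sum_add exp_add[symmetric] algebra_simps)
    have "prob (cylinder (u @ v)) \<le> K * (G u x * G v ?y)" using up[OF w x] by (simp add: G)
    also have "\<dots> \<le> K * ((K * prob (cylinder u)) * (K * prob (cylinder v)))"
      using K G0 low[OF uv(1) xu] low[OF uv(2) yv]
      by (intro mult_left_mono mult_mono) (auto intro: less_imp_le)
    finally have 1: "prob (cylinder (u @ v)) \<le> K ^ 3 * prob (cylinder u) * prob (cylinder v)"
      by (simp add: power3_eq_cube mult_ac)
    have "prob (cylinder u) * prob (cylinder v) \<le> (K * G u x) * (K * G v ?y)"
      using K G0 up[OF uv(1) xu] up[OF uv(2) yv]
      by (intro mult_mono) (auto intro: less_imp_le)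
    also have "\<dots> = K * K * G (u @ v) x" by (simp add: G mult_ac)
    also have "\<dots> \<le> K * K * (K * prob (cylinder (u @ v)))"
      using K low[OF w x] by (intro mult_left_mono) auto
    finally show ?thesis using 1 by (simp add: power3_eq_cube mult_ac)
  qed
  have "quasi_bernoulli \<mu> (K ^ 3)"
  proof unfold_locales
    show "emeasure \<mu> (shift -` A \<inter> space \<mu>) = emeasure \<mu> A" if "A \<in> sets \<mu>" for A
      using inv that by (simp add: invariant_prob_def)
    show "1 \<le> K ^ 3" using K by (intro one_le_power) simp
  qed (use sets pos append in auto)
  then show thesis by (rule that)
qed

theorem theorem3p6:
  fixes \<theta> \<kappa> \<eta> :: real
    and \<phi> :: "(nat \<Rightarrow> nat) \<Rightarrow> real"
    and \<mu> :: "(nat \<Rightarrow> nat) measure"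
  assumes "0 < \<theta>" and "\<theta> < 1"
    and "1 < \<kappa>"
    and "\<And>n x. 1 \<le> n \<Longrightarrow> x \<in> cylinder [n] \<Longrightarrow> \<phi> x \<le> - \<kappa> * ln (real n + 1)"
    and "gibbs_measure \<phi> \<mu>"
    and "0 < \<eta>"
  shows "\<exists>c C \<epsilon>. 0 < c \<and> c < C \<and> 0 < \<epsilon> \<and>
    (\<forall>\<delta>>0.
      ennreal c / min_ball_measure \<theta> \<mu> (\<delta> / \<epsilon>) \<le> expected_covering_time \<theta> \<mu> \<delta> \<and>
      (\<eta> \<le> \<bar>\<delta> - 1\<bar> \<longrightarrow>
        expected_covering_time \<theta> \<mu> \<delta>
          \<le> ennreal C / min_ball_measure \<theta> \<mu> (\<epsilon> * \<delta>) * ennreal ((ln (1 / \<delta>))\<^sup>2)))"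
proof -
  note \<theta> = assms(1,2) and \<eta> = assms(6)
  obtain D where "quasi_bernoulli \<mu> D" by (rule gibbs_measure_quasi_bernoulli[OF assms(5)])
  then interpret quasi_bernoulli \<mu> D .
  obtain C1 where C1: "0 < C1" "\<And>\<delta>. 0 < \<delta> \<Longrightarrow> \<delta> \<le> 1 - \<eta> \<Longrightarrow> expected_covering_time \<theta> \<mu> \<delta>
      \<le> ennreal C1 / min_ball_measure \<theta> \<mu> ((1 - \<theta>) / 32 * \<delta>) * ennreal ((ln (1 / \<delta>))\<^sup>2)"
    using expected_covering_time_le_small[OF \<theta> \<eta>] by blast
  obtain C2 where C2: "0 < C2" "\<And>\<delta> r. 1 + \<eta> \<le> \<delta> \<Longrightarrow> expected_covering_time \<theta> \<mu> \<delta>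
      \<le> ennreal C2 / min_ball_measure \<theta> \<mu> r * ennreal ((ln (1 / \<delta>))\<^sup>2)"
    using expected_covering_time_le_large[OF \<theta> \<eta>] by blast
  define C where "C = C1 + C2 + 1"
  define \<epsilon> where "\<epsilon> = (1 - \<theta>) / 32"
  have \<epsilon>: "0 < \<epsilon>" "\<epsilon> < 1" using \<theta> by (auto simp: \<epsilon>_def)
  have C_mono: "ennreal C' / M * b \<le> ennreal C / M * b" if "C' \<le> C" for C' M b
    using that by (intro mult_right_mono divide_right_mono_ennreal ennreal_leI) auto
  have "ennreal (1 / 8) / min_ball_measure \<theta> \<mu> (\<delta> / \<epsilon>) \<le> expected_covering_time \<theta> \<mu> \<delta>"
    if "0 < \<delta>" for \<delta>
    using that \<epsilon> by (intro expected_covering_time_ge[OF \<theta>]) (auto simp: field_simps)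
  moreover have "expected_covering_time \<theta> \<mu> \<delta>
      \<le> ennreal C / min_ball_measure \<theta> \<mu> (\<epsilon> * \<delta>) * ennreal ((ln (1 / \<delta>))\<^sup>2)"
    if \<delta>: "0 < \<delta>" "\<eta> \<le> \<bar>\<delta> - 1\<bar>" for \<delta>
  proof (cases "\<delta> < 1")
    case True
    then have "\<delta> \<le> 1 - \<eta>" using \<delta> by simp
    then show ?thesis
      unfolding \<epsilon>_def using C1 C2(1) \<delta>(1) by (intro order_trans[OF C1(2) C_mono]) (auto simp: C_def)
  next
    case False
    then have "1 + \<eta> \<le> \<delta>" using \<delta> by simp
    then show ?thesis
      using C1(1) C2(1) by (intro order_trans[OF C2(2) C_mono]) (auto simp: C_def)
  qed
  ultimately show ?thesis
    using C1(1) C2(1) \<epsilon>(1)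
    by (intro exI[of _ "1 / 8"] exI[of _ C] exI[of _ \<epsilon>]) (auto simp: C_def)
qed

end
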